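(* Assume $1<|\mathcal X|<|\mathcal Y|$ and $\mathcal W_\kappa(\mathcal Y,\mathcal E)\neq\emptyset$. Then $\mathcal W_\kappa(\mathcal Y,\mathcal E)$ forms an e-family if and only if $$\dim\left(\operatorname{span}(\mathcal G_\kappa(\mathcal Y,\mathcal E))+\mathcal N(\mathcal Y,\mathcal E)\right)=|\mathcal E|+|\mathcal Y|+|\mathcal D|-|\mathcal X|-\sum_{(x,x')\in\mathcal D}|\mathcal S_x| .$$
   Context: Let $\mathcal Y$ be a finite set and $\mathcal E\subset\mathcal Y^2$ a nonempty edge set such that the digraph $(\mathcal Y,\mathcal E)$ is strongly connected. $\mathcal F(\mathcal Y,\mathcal E)=\mathbb R^{\mathcal E}$ is the space of real functions on $\mathcal E$, identified with real $\mathcal Y\times\mathcal Y$ matrices vanishing outside $\mathcal E$; $\mathcal F^+(\mathcal Y,\mathcal E)$ is the subset of those that are strictly positive on $\mathcal E$; $\mathcal W(\mathcal Y,\mathcal E)\subset\mathcal F^+(\mathcal Y,\mathcal E)$ is the set of row-stochastic ones. Let $\kappa\colon\mathcal Y\to\mathcal X$ be surjective, $\mathcal S_x=\kappa^{-1}(x)$, $\mathcal D=\{(\kappa(y),\kappa(y')):(y,y')\in\mathcal E\}$, and write $F(y,\mathcal S_{x'})=\sum_{y'\in\mathcal S_{x'}}F(y,y')$. $F\in\mathcal F(\mathcal Y,\mathcal E)$ is $\kappa$-lumpable if $F(y_1,\mathcal S_{x'})=F(y_2,\mathcal S_{x'})$ for all $(x,x')\in\mathcal D$ and $y_1,y_2\in\mathcal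 S_x$. $\mathcal F^+_\kappa(\mathcal Y,\mathcal E)$ and $\mathcal W_\kappa(\mathcal Y,\mathcal E)$ are the sets of $\kappa$-lumpable elements of $\mathcal F^+(\mathcal Y,\mathcal E)$ and $\mathcal W(\mathcal Y,\mathcal E)$. $\mathcal G_\kappa(\mathcal Y,\mathcal E)=\{\log F:F\in\mathcal F_\kappa^+(\mathcal Y,\mathcal E)\}\subset\mathcal F(\mathcal Y,\mathcal E)$, with $\log$ entrywise on $\mathcal E$; $\operatorname{span}$ is the linear span in $\mathcal F(\mathcal Y,\mathcal E)$. E-families: for $F\in\mathcal F^+(\mathcal Y,\mathcal E)$ with Perron–Frobenius root $\rho_F$ and positive right eigenvector $v_F$, put $\mathfrak s(F)(y,y')=\frac{F(y,y')v_F(y')}{\rho_F v_F(y)}$, so $\mathfrak s(F)\in\mathcal W(\mathcal Y,\mathcal E)$. Let $\mathcal N(\mathcal Y,\mathcal E)$ be the linear space of $N\in\mathcal F(\mathcal Y,\mathcal E)$ of the form $N(y,y')=f(y')-f(y)+c$ with $f\in\mathbb R^{\mathcal Y}$, $c\in\mathbb R$. A set $\mathcal V\subset\mathcal W(\mathcal Y,\mathcal E)$ forms an e-family (of dimension $d\ge 0$) if there are $K\in\mathcal F(\mathcal Y,\mathcal E)$ and $G_1,\dots,G_d\in\mathcal F(\mathcal Y,\mathcal E)$, linearly independent modulo $\mathcal N(\mathcal Y,\mathcal E)$, with $\mathcal V=\{\mathfrak s(\exp(K+\sum_{i=1}^d\theta^iG_i)):\theta\in\mathbb R^d\}$, where $\exp$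 is applied entrywise on $\mathcal E$. *)

theory Defs
  imports "HOL-Analysis.Analysis"
begin

text \<open>
  The vertex set is the finite type \<open>'y\<close>, and the set of lumped states is the finite type
  \<open>'x\<close>. Real functions on the edge set are the \<open>'y\<close> by \<open>'y\<close> matrices vanishing outside it, so
  that spans, sums of subspaces and dimensions are those of \<open>real ^ 'y ^ 'y\<close>.
\<close>

type_synonym 'y rmatrix = "real ^ 'y ^ 'y"

definition edge_funs :: "('y::finite) rel \<Rightarrow> 'y rmatrix set" where
  "edge_funs E = {F. \<forall>y y'. (y, y') \<notin> E \<longrightarrow> F $ y $ y' = 0}"

definition pos_edge_funs :: "('y::finite) rel \<Rightarrow> 'y rmatrix set" where
  "pos_edge_funs E = {F \<in> edge_funs E. \<forall>(y, y') \<in> E. F $ y $ y' > 0}"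

definition stochastic_mats :: "('y::finite) rel \<Rightarrow> 'y rmatrix set" where
  "stochastic_mats E = {F \<in> pos_edge_funs E. \<forall>y. (\<Sum>y'\<in>UNIV. F $ y $ y') = 1}"

definition strongly_connected_rel :: "'y rel \<Rightarrow> bool" where
  "strongly_connected_rel E \<longleftrightarrow> (\<forall>y y'. (y, y') \<in> E\<^sup>*)"

definition fiber :: "('y \<Rightarrow> 'x) \<Rightarrow> 'x \<Rightarrow> 'y set" where
  "fiber \<kappa> x = \<kappa> -` {x}"

definition lumped_edges :: "('y \<Rightarrow> 'x) \<Rightarrow> 'y rel \<Rightarrow> 'x rel" where
  "lumped_edges \<kappa> E = {(\<kappa> y, \<kappa> y') | y y'. (y, y') \<in> E}"

definition row_mass :: "('y::finite) rmatrix \<Rightarrow> 'y \<Rightarrow> 'y set \<Rightarrow> real" where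
  "row_mass F y S = (\<Sum>y'\<in>S. F $ y $ y')"

definition lumpable :: "('y::finite \<Rightarrow> 'x) \<Rightarrow> 'y rel \<Rightarrow> 'y rmatrix \<Rightarrow> bool" where
  "lumpable \<kappa> E F \<longleftrightarrow>
     (\<forall>(x, x') \<in> lumped_edges \<kappa> E. \<forall>y\<^sub>1 \<in> fiber \<kappa> x. \<forall>y\<^sub>2 \<in> fiber \<kappa> x.
        row_mass F y\<^sub>1 (fiber \<kappa> x') = row_mass F y\<^sub>2 (fiber \<kappa> x'))"

definition lumpable_pos_edge_funs :: "('y::finite \<Rightarrow> 'x) \<Rightarrow> 'y rel \<Rightarrow> 'y rmatrix set" where
  "lumpable_pos_edge_funs \<kappa> E = {F \<in> pos_edge_funs E. lumpable \<kappa> E F}"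

definition lumpable_stochastic_mats :: "('y::finite \<Rightarrow> 'x) \<Rightarrow> 'y rel \<Rightarrow> 'y rmatrix set" where
  "lumpable_stochastic_mats \<kappa> E = {F \<in> stochastic_mats E. lumpable \<kappa> E F}"

definition log_on :: "('y::finite) rel \<Rightarrow> 'y rmatrix \<Rightarrow> 'y rmatrix" where
  "log_on E F = (\<chi> y y'. if (y, y') \<in> E then ln (F $ y $ y') else 0)"

definition exp_on :: "('y::finite) rel \<Rightarrow> 'y rmatrix \<Rightarrow> 'y rmatrix" where
  "exp_on E F = (\<chi> y y'. if (y, y') \<in> E then exp (F $ y $ y') else 0)"

definition log_lumpable :: "('y::finite \<Rightarrow> 'x) \<Rightarrow> 'y rel \<Rightarrow> 'y rmatrix set" where
  "log_lumpable \<kappa> E = log_on E ` lumpable_pos_edge_funs \<kappa> E"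

definition null_space :: "('y::finite) rel \<Rightarrow> 'y rmatrix set" where
  "null_space E =
     {(\<chi> y y'. if (y, y') \<in> E then f y' - f y + c else 0) | (f :: 'y \<Rightarrow> real) (c :: real). True}"

text \<open>
  The Perron-Frobenius root of an irreducible nonnegative matrix is its spectral radius, taken
  over the complex eigenvalues.
\<close>

definition pf_root :: "('y::finite) rmatrix \<Rightarrow> real" where
  "pf_root F = Sup {cmod z | z. \<exists>w :: complex ^ 'y. w \<noteq> 0 \<and>
     (\<chi> y y'. complex_of_real (F $ y $ y')) *v w = z *s w}"

text \<open>
  By the Perron-Frobenius theorem, for irreducible nonnegative \<open>F\<close> a positive right eigenvector
  exists and is unique up to a positive factor, which cancels in \<open>stoch_normalize\<close>.
\<close>

definition pf_vec :: "('y::finite) rmatrix \<Rightarrow> real ^ 'y" where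
  "pf_vec F = (SOME v. (\<forall>y. v $ y > 0) \<and> F *v v = pf_root F *s v)"

definition stoch_normalize :: "('y::finite) rmatrix \<Rightarrow> 'y rmatrix" where
  "stoch_normalize F =
     (\<chi> y y'. F $ y $ y' * pf_vec F $ y' / (pf_root F * pf_vec F $ y))"

definition independent_modulo ::
    "('y::finite) rmatrix set \<Rightarrow> nat \<Rightarrow> (nat \<Rightarrow> 'y rmatrix) \<Rightarrow> bool" where
  "independent_modulo N d G \<longleftrightarrow>
     (\<forall>a :: nat \<Rightarrow> real. (\<Sum>i=1..d. a i *\<^sub>R G i) \<in> N \<longrightarrow> (\<forall>i\<in>{1..d}. a i = 0))"

text \<open>
  Only the values of \<open>G\<close> and of the parameter \<open>\<theta>\<close> on the indices from 1 to \<open>d\<close> matter.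
\<close>

definition e_family :: "('y::finite) rel \<Rightarrow> 'y rmatrix set \<Rightarrow> bool" where
  "e_family E V \<longleftrightarrow> V \<subseteq> stochastic_mats E \<and>
     (\<exists>(d :: nat) K G. K \<in> edge_funs E \<and> (\<forall>i\<in>{1..d}. G i \<in> edge_funs E) \<and>
        independent_modulo (null_space E) d G \<and>
        V = {stoch_normalize (exp_on E (K + (\<Sum>i=1..d. \<theta> i *\<^sub>R G i))) | \<theta> :: nat \<Rightarrow> real. True})"

end

theory Submission
  imports Defs
begin

text \<open>
  Work on the logarithmic scale. Normalizing a positive matrix translates its logarithm by an element
  of the null space, and translations by the null space do not change the normalization. Moreover
  the positive eigenvector of a lumpable matrix is constant on fibers (\<open>lumped_eigenpair\<close>), so
  normalization preserves lumpability. Hence the lumpable stochastic matrices correspond to the set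
  \<open>S = log_lumpable \<kappa> E + null_space E\<close>, which is closed under translations by the null space, and
  they form an e-family exactly when \<open>S\<close> is a linear subspace. If \<open>S\<close> is a subspace, a basis of a
  complement of the null space gives the family (\<open>e_family_if_gauge_subspace\<close>). Conversely an
  e-family makes \<open>S\<close> an affine space, and this space contains \<open>0\<close> because the differences of
  elements of \<open>log_lumpable \<kappa> E\<close> already span this set (\<open>log_lumpable_subset\<close>).

  It remains to see that \<open>S\<close> is a subspace if and only if \<open>U = span (log_lumpable \<kappa> E) + null_space E\<close>
  has the stated dimension. The set \<open>S\<close> is parametrized by
  \<open>(F, f) \<mapsto> log F + (f(y') - f(y))\<close>, where \<open>F\<close> is positive and lumpable and \<open>f\<close> vanishes at one
  chosen point of each fiber. The parameters form a nonempty open subset of a linear space whose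
  dimension is exactly the number in the theorem (\<open>dim_lumpable_edge_funs\<close>, \<open>dim_section_null\<close>).
  The parametrization is continuous and, by uniqueness of the Perron--Frobenius eigenvector,
  injective. Its inverse is continuous and its image \<open>S\<close> is closed: by an estimate of the
  ratios of the entries of the eigenvector, \<open>f\<close> stays bounded when the logarithm does
  (\<open>gauge_bounded\<close>), so compactness applies. If \<open>dim U\<close> is the dimension of the parameters, then \<open>S\<close>
  is open in \<open>U\<close> by invariance of domain, and being closed it equals \<open>U\<close>. If \<open>S\<close> is a
  subspace, then it equals \<open>U\<close>, and invariance of dimension for the parametrization and for its
  inverse gives the dimension.
\<close>

section \<open>Perron--Frobenius theory from positive eigenvectors\<close>

definition positive_eigenpair :: "('n::finite) rmatrix \<Rightarrow> real ^ 'n \<Rightarrow> real \<Rightarrow> bool" where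
  "positive_eigenpair A v l \<longleftrightarrow> (\<forall>i. v $ i > 0) \<and> (\<forall>i. (\<Sum>j\<in>UNIV. A $ i $ j * v $ j) = l * v $ i)"

lemma positive_eigenpairD:
  assumes "positive_eigenpair A v l"
  shows "v $ i > 0" "(\<Sum>j\<in>UNIV. A $ i $ j * v $ j) = l * v $ i"
  using assms by (auto simp: positive_eigenpair_def)

lemma positive_eigenpair_iff:
  "positive_eigenpair A v l \<longleftrightarrow> (\<forall>i. v $ i > 0) \<and> A *v v = l *s v"
  by (auto simp: positive_eigenpair_def matrix_vector_mult_def vector_scalar_mult_def vec_eq_iff)

lemma pos_edge_funs_nonneg: "A \<in> pos_edge_funs E \<Longrightarrow> 0 \<le> A $ i $ j"
  by (cases "(i, j) \<in> E") (force simp: pos_edge_funs_def edge_funs_def)+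

lemma pos_edge_funs_pos: "A \<in> pos_edge_funs E \<Longrightarrow> (i, j) \<in> E \<Longrightarrow> 0 < A $ i $ j"
  by (auto simp: pos_edge_funs_def)

lemma strongly_connected_predecessor:
  assumes "E \<noteq> {}" "strongly_connected_rel E"
  obtains i where "(i, j) \<in> E"
proof -
  obtain a b where ab: "(a, b) \<in> E" using assms(1) by auto
  have "(b, j) \<in> E\<^sup>*" using assms(2) by (auto simp: strongly_connected_rel_def)
  thus thesis by (cases rule: rtranclE) (use ab that in auto)
qed

lemma eigenvalue_pos:
  assumes E: "E \<noteq> {}" "strongly_connected_rel E" and A: "A \<in> pos_edge_funs E"
    and v: "positive_eigenpair A v l"
  shows "l > 0"
proof -
  obtain i j where ij: "(i, j) \<in> E" using E(1) by auto
  have "0 < A $ i $ j * v $ j"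
    using pos_edge_funs_pos[OF A ij] positive_eigenpairD(1)[OF v] by simp
  also have "\<dots> \<le> (\<Sum>j\<in>UNIV. A $ i $ j * v $ j)"
    using pos_edge_funs_nonneg[OF A] positive_eigenpairD(1)[OF v]
    by (intro member_le_sum) (auto intro!: mult_nonneg_nonneg simp: less_imp_le)
  also have "\<dots> = l * v $ i" by (rule positive_eigenpairD(2)[OF v])
  finally show ?thesis
    using positive_eigenpairD(1)[OF v, of i] by (simp add: zero_less_mult_iff)
qed

text \<open>
  In the maximum norm with weights \<open>v\<close>, the operator norm of \<open>A\<close> is at most \<open>l\<close>, because a vector
  dominated by \<open>m v\<close> is mapped to one dominated by \<open>l m v\<close>.
\<close>

lemma eigenvalue_bound:
  fixes A :: "('n::finite) rmatrix"
  assumes A: "\<And>i j. 0 \<le> A $ i $ j" and v: "positive_eigenpair A v l"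
    and w: "w \<noteq> 0" "(\<chi> i j. complex_of_real (A $ i $ j)) *v w = z *s w"
  shows "cmod z \<le> l"
proof -
  \<comment> \<open>The weighted maximum norm of w; the estimate is read off at a coordinate k attaining it.\<close>
  define m where "m = Max (range (\<lambda>i. cmod (w $ i) / v $ i))"
  note vpos = positive_eigenpairD(1)[OF v]
  have le: "cmod (w $ i) \<le> m * v $ i" for i
  proof -
    have "cmod (w $ i) / v $ i \<le> m" unfolding m_def by (intro Max_ge) auto
    thus ?thesis using vpos[of i] by (simp add: field_simps)
  qed
  have "m \<in> range (\<lambda>i. cmod (w $ i) / v $ i)" unfolding m_def by (intro Max_in) auto
  then obtain k where k: "m = cmod (w $ k) / v $ k" by auto
  obtain i where i: "w $ i \<noteq> 0" using w(1) by (auto simp: vec_eq_iff)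
  have "0 < m * v $ i" using le[of i] i by (smt (verit) zero_less_norm_iff)
  hence m: "m > 0" using vpos[of i] by (simp add: zero_less_mult_iff)
  have "cmod z * (m * v $ k) = cmod (z * w $ k)" using vpos[of k] by (simp add: k norm_mult)
  also have "z * w $ k = (\<Sum>j\<in>UNIV. of_real (A $ k $ j) * w $ j)"
    using arg_cong[OF w(2), of "\<lambda>u. u $ k"] by (simp add: matrix_vector_mult_def)
  also have "cmod \<dots> \<le> (\<Sum>j\<in>UNIV. A $ k $ j * (m * v $ j))"
    by (intro sum_norm_le) (auto simp: norm_mult A le intro!: mult_left_mono)
  also have "\<dots> = l * (m * v $ k)"
    using positive_eigenpairD(2)[OF v, of k]
    by (metis (no_types, lifting) mult.left_commute sum.cong sum_distrib_left)
  finally show ?thesis using m vpos[of k] by simp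
qed

text \<open>
  Any positive eigenvector certifies its eigenvalue as the spectral radius. This is what allows the
  Perron--Frobenius data of a lumpable matrix to be read off from those of its lumped matrix.
\<close>

lemma pf_root_eq:
  fixes A :: "('n::finite) rmatrix"
  assumes A: "A \<in> pos_edge_funs E" and v: "positive_eigenpair A v l"
  shows "pf_root A = l"
  unfolding pf_root_def
proof (rule cSup_eq_maximum)
  fix i :: 'n
  have "0 \<le> (\<Sum>j\<in>UNIV. A $ i $ j * v $ j)"
    using pos_edge_funs_nonneg[OF A] positive_eigenpairD(1)[OF v]
    by (intro sum_nonneg mult_nonneg_nonneg) (auto intro: less_imp_le)
  hence "0 \<le> l * v $ i" using positive_eigenpairD(2)[OF v] by simp
  hence l: "0 \<le> l" using positive_eigenpairD(1)[OF v, of i] by (simp add: zero_le_mult_iff)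
  have "(\<chi> i j. complex_of_real (A $ i $ j)) *v (\<chi> i. of_real (v $ i)) = of_real l *s (\<chi> i. of_real (v $ i))"
    using positive_eigenpairD(2)[OF v]
    by (simp add: vec_eq_iff matrix_vector_mult_def flip: of_real_mult of_real_sum)
  moreover have "(\<chi> i. complex_of_real (v $ i)) \<noteq> 0"
    using positive_eigenpairD(1)[OF v] by (simp add: vec_eq_iff less_imp_neq[symmetric])
  moreover have "cmod (of_real l) = l" using l by simp
  ultimately show "l \<in> {cmod z |z. \<exists>w::complex^'n. w \<noteq> 0 \<and>
    (\<chi> y y'. complex_of_real (A $ y $ y')) *v w = z *s w}"
    by (metis (mono_tags, lifting) mem_Collect_eq)
qed (use eigenvalue_bound[OF pos_edge_funs_nonneg[OF A] v] in auto)

text \<open>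
  At a zero of \<open>u\<close> the eigenvalue equation is a vanishing sum of nonnegative terms, so \<open>u\<close> vanishes
  at all successors, and strong connectedness carries the zero everywhere. Uniqueness and positivity
  of the Perron--Frobenius eigenvector both rest on this.
\<close>

lemma eigenvector_propagates_zeros:
  assumes E: "strongly_connected_rel E" and A: "A \<in> pos_edge_funs E"
    and u: "\<And>i. 0 \<le> u $ i" "\<And>i. (\<Sum>j\<in>UNIV. A $ i $ j * u $ j) = l * u $ i"
    and z: "u $ i = 0"
  shows "u $ j = 0"
proof -
  have "(i, j) \<in> E\<^sup>*" using E by (auto simp: strongly_connected_rel_def)
  thus ?thesis
  proof (induction rule: rtrancl_induct)
    case (step a b)
    have "(\<Sum>j\<in>UNIV. A $ a $ j * u $ j) = 0" using u(2)[of a] step by simp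
    hence "A $ a $ b * u $ b = 0"
      using pos_edge_funs_nonneg[OF A] u(1) by (subst (asm) sum_nonneg_eq_0_iff) auto
    thus ?case using pos_edge_funs_pos[OF A step(2)] by simp
  qed (rule z)
qed

text \<open>
  Subtract from \<open>w\<close> the largest multiple of \<open>v\<close> that leaves a nonnegative vector: the difference is a
  nonnegative eigenvector with a zero, hence it is zero.
\<close>

lemma positive_eigenvector_unique:
  fixes A :: "('n::finite) rmatrix"
  assumes E: "strongly_connected_rel E" and A: "A \<in> pos_edge_funs E"
    and v: "positive_eigenpair A v l" and w: "positive_eigenpair A w l'"
  obtains c where "c > 0" "\<And>i. w $ i = c * v $ i"
proof -
  have l': "l' = l" using pf_root_eq[OF A v] pf_root_eq[OF A w] by simp
  define c where "c = Min (range (\<lambda>i. w $ i / v $ i))"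
  note vpos = positive_eigenpairD(1)[OF v] note wpos = positive_eigenpairD(1)[OF w]
  have "c \<in> range (\<lambda>i. w $ i / v $ i)" unfolding c_def by (intro Min_in) auto
  then obtain k where k: "c = w $ k / v $ k" by auto
  have "0 \<le> (w - c *\<^sub>R v) $ i" for i
  proof -
    have "c \<le> w $ i / v $ i" unfolding c_def by (intro Min_le) auto
    thus ?thesis using vpos[of i] by (simp add: field_simps)
  qed
  moreover have "(\<Sum>j\<in>UNIV. A $ i $ j * (w - c *\<^sub>R v) $ j) = l * (w - c *\<^sub>R v) $ i" for i
  proof -
    have "(\<Sum>j\<in>UNIV. A $ i $ j * (w - c *\<^sub>R v) $ j)
        = (\<Sum>j\<in>UNIV. A $ i $ j * w $ j) - c * (\<Sum>j\<in>UNIV. A $ i $ j * v $ j)"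
      by (simp add: sum_distrib_left sum_subtractf algebra_simps)
    thus ?thesis
      using positive_eigenpairD(2)[OF v, of i] positive_eigenpairD(2)[OF w, of i] l'
      by (simp add: algebra_simps)
  qed
  moreover have "(w - c *\<^sub>R v) $ k = 0" using k vpos[of k] by simp
  ultimately have "(w - c *\<^sub>R v) $ i = 0" for i
    by (rule eigenvector_propagates_zeros[OF E A])
  moreover have "c > 0" using k vpos wpos by simp
  ultimately show thesis by (intro that[of c]) auto
qed

text \<open>
  By uniqueness, the normalization may be computed from any positive eigenvector, whichever one the
  choice in \<^const>\<open>pf_vec\<close> has picked.
\<close>

lemma stoch_normalize_eq:
  fixes A :: "('n::finite) rmatrix"
  assumes E: "E \<noteq> {}" "strongly_connected_rel E" and A: "A \<in> pos_edge_funs E"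
    and v: "positive_eigenpair A v l"
  shows "stoch_normalize A = (\<chi> i j. A $ i $ j * v $ j / (l * v $ i))"
proof -
  have root: "pf_root A = l" by (rule pf_root_eq[OF A v])
  have "positive_eigenpair A (pf_vec A) l"
    unfolding pf_vec_def root positive_eigenpair_iff
    by (rule someI[where x = v]) (use v in \<open>simp add: positive_eigenpair_iff\<close>)
  then obtain c where "c > 0" "\<And>i. pf_vec A $ i = c * v $ i"
    using positive_eigenvector_unique[OF E(2) A v] by metis
  thus ?thesis by (simp add: stoch_normalize_def root vec_eq_iff field_simps)
qed

text \<open>
  The Perron--Frobenius existence theorem, from Brouwer's fixed point theorem for
  \<open>v \<mapsto> A v / \<parallel>A v\<parallel>\<^sub>1\<close> on the standard simplex. The map is well defined because every vertex has a
  predecessor, so that \<open>A v\<close> does not vanish on the simplex; a fixed point is positive because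
  zeros of eigenvectors propagate.
\<close>

lemma positive_eigenpair_exists:
  fixes E :: "('n::finite) rel"
  assumes E: "E \<noteq> {}" "strongly_connected_rel E" and A: "A \<in> pos_edge_funs E"
  obtains v l where "positive_eigenpair A v l"
proof -
  define S :: "(real ^ 'n) set" where "S = {v. (\<forall>i. 0 \<le> v $ i) \<and> (\<Sum>i\<in>UNIV. v $ i) = 1}"
  define s where "s = (\<lambda>v. \<Sum>i\<in>UNIV. (A *v v) $ i)"
  define f where "f = (\<lambda>v. inverse (s v) *\<^sub>R (A *v v))"
  note A0 = pos_edge_funs_nonneg[OF A]
  have nonneg: "0 \<le> (A *v v) $ i" if "v \<in> S" for v i
    using that A0 by (auto simp: S_def matrix_vector_mult_def intro!: sum_nonneg)
  have spos: "0 < s v" if v: "v \<in> S" for v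
  proof -
    obtain j where j: "v $ j \<noteq> 0"
      using v unfolding S_def by (metis (mono_tags, lifting) mem_Collect_eq sum.neutral zero_neq_one)
    obtain i where i: "(i, j) \<in> E" by (rule strongly_connected_predecessor[OF E])
    have vj: "0 < v $ j" using v j by (auto simp: S_def less_le)
    have "0 < A $ i $ j * v $ j" using pos_edge_funs_pos[OF A i] vj by simp
    also have "\<dots> \<le> (A *v v) $ i"
      unfolding matrix_vector_mult_def using v A0
      by (simp, intro member_le_sum) (auto simp: S_def)
    also have "\<dots> \<le> s v" unfolding s_def using nonneg[OF v] by (intro member_le_sum) auto
    finally show ?thesis .
  qed
  have closed: "closed S"
  proof -
    have "S = (\<Inter>i. {v. 0 \<le> v $ i}) \<inter> {v. (\<Sum>i\<in>UNIV. v $ i) = 1}" by (auto simp: S_def)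
    thus ?thesis
      by (auto intro!: closed_INT closed_Collect_le closed_Collect_eq continuous_intros)
  qed
  have "norm v \<le> 1" if "v \<in> S" for v
    using that norm_le_l1_cart[of v] by (simp add: S_def)
  hence "bounded S" unfolding bounded_iff by blast
  hence comp: "compact S" using closed by (simp add: compact_eq_bounded_closed)
  have conv: "convex S"
    by (auto simp: convex_def S_def sum.distrib simp flip: sum_distrib_left)
  obtain i0 :: 'n where True by auto
  have "axis i0 1 \<in> S" by (auto simp: S_def axis_def)
  hence ne: "S \<noteq> {}" by auto
  have cont: "continuous_on S f"
    unfolding f_def s_def matrix_vector_mult_def using spos[unfolded s_def matrix_vector_mult_def]
    by (intro continuous_intros) (auto simp: less_imp_neq[symmetric])
  have "f v \<in> S" if v: "v \<in> S" for v
  proof -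
    have "(\<Sum>i\<in>UNIV. f v $ i) = inverse (s v) * s v" by (simp add: f_def s_def sum_distrib_left)
    thus ?thesis using spos[OF v] nonneg[OF v] by (auto simp: S_def f_def)
  qed
  hence "f \<in> S \<rightarrow> S" by auto
  then obtain v where v: "v \<in> S" "f v = v" using brouwer[OF comp conv ne cont] by metis
  have eq: "A *v v = s v *\<^sub>R v"
  proof -
    have "s v *\<^sub>R f v = A *v v" using spos[OF v(1)] by (simp add: f_def)
    thus ?thesis by (simp add: v(2))
  qed
  have ev: "(\<Sum>j\<in>UNIV. A $ i $ j * v $ j) = s v * v $ i" for i
    using arg_cong[OF eq, of "\<lambda>u. u $ i"] by (simp add: matrix_vector_mult_def)
  have v0: "0 \<le> v $ i" for i using v(1) by (simp add: S_def)
  have "0 < v $ i" for i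
  proof (rule ccontr)
    assume "\<not> 0 < v $ i"
    hence "v $ i = 0" using v0[of i] by simp
    from eigenvector_propagates_zeros[OF E(2) A v0 ev this] have "v $ j = 0" for j .
    thus False using v(1) by (simp add: S_def)
  qed
  thus thesis using ev by (intro that[of v "s v"]) (auto simp: positive_eigenpair_def)
qed

text \<open>
  A bound on the growth of \<open>w\<close> along single edges multiplies up along paths. The constant depends on
  the graph and on \<open>c\<close> only, which is what compactness will need.
\<close>

lemma path_harnack:
  fixes E :: "('n::finite) rel"
  assumes E: "strongly_connected_rel E"
  shows "\<exists>C. \<forall>w :: 'n \<Rightarrow> real. (\<forall>i. 0 < w i) \<longrightarrow> (\<forall>(i, j)\<in>E. w j \<le> c * w i) \<longrightarrow>
    (\<forall>i j. w j \<le> C * w i)"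
proof -
  define P where "P = (\<lambda>w :: 'n \<Rightarrow> real. (\<forall>i. 0 < w i) \<and> (\<forall>(i, j)\<in>E. w j \<le> c * w i))"
  have "\<exists>C. \<forall>w. P w \<longrightarrow> w j \<le> C * w i" for i j
  proof -
    have "(i, j) \<in> E\<^sup>*" using E by (auto simp: strongly_connected_rel_def)
    thus ?thesis
    proof (induction rule: rtrancl_induct)
      case base
      show ?case by (rule exI[of _ 1]) simp
    next
      case (step a b)
      then obtain C where C: "\<And>w. P w \<Longrightarrow> w a \<le> C * w i" by blast
      have "w b \<le> (max c 0 * C) * w i" if w: "P w" for w
      proof -
        have "w b \<le> c * w a" using w step by (auto simp: P_def)
        also have "\<dots> \<le> max c 0 * w a"
          using w by (intro mult_right_mono) (auto simp: P_def less_imp_le)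
        also have "\<dots> \<le> max c 0 * (C * w i)" using C[OF w] by (intro mult_left_mono) auto
        finally show ?thesis by (simp add: mult.assoc)
      qed
      thus ?case by blast
    qed
  qed
  hence "\<forall>i j. \<exists>C. \<forall>w. P w \<longrightarrow> w j \<le> C * w i" by blast
  then obtain C where C: "\<And>i j w. P w \<Longrightarrow> w j \<le> C i j * w i" unfolding choice_iff by blast
  define M where "M = Max (range (\<lambda>(i, j). C i j))"
  have M: "C i j \<le> M" for i j unfolding M_def by (intro Max_ge) (auto intro: rev_image_eqI[of "(i, j)"])
  have "w j \<le> M * w i" if w: "P w" for w i j
  proof -
    have "w j \<le> C i j * w i" by (rule C[OF w])
    also have "\<dots> \<le> M * w i"
      using M w by (intro mult_right_mono) (auto simp: P_def less_imp_le)
    finally show ?thesis .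
  qed
  thus ?thesis unfolding P_def by blast
qed

text \<open>
  For matrices whose entries on the edges lie between fixed positive bounds, the ratios of the
  entries of the positive eigenvector are bounded uniformly: at a maximal entry of the eigenvector
  the eigenvalue is at most \<open>n b\<close>, and then one edge changes the eigenvector by a factor of at most
  \<open>n b / a\<close>.
\<close>

lemma eigenvector_harnack:
  fixes E :: "('n::finite) rel"
  assumes E: "strongly_connected_rel E" and a: "a > 0"
  obtains C where "\<And>A w l i j. A \<in> pos_edge_funs E \<Longrightarrow> (\<And>i j. (i, j) \<in> E \<Longrightarrow> a \<le> A $ i $ j) \<Longrightarrow>
     (\<And>i j. A $ i $ j \<le> b) \<Longrightarrow> positive_eigenpair A w l \<Longrightarrow> w $ j \<le> C * w $ i"
proof -
  define c where "c = real CARD('n) * b / a"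
  obtain C where C: "\<And>w :: 'n \<Rightarrow> real. \<forall>i. 0 < w i \<Longrightarrow> \<forall>(i, j)\<in>E. w j \<le> c * w i \<Longrightarrow>
      \<forall>i j. w j \<le> C * w i"
    using path_harnack[OF E, of c] by metis
  show thesis
  proof (rule that[of C])
    fix A w l i j
    assume A: "A \<in> pos_edge_funs E" and lo: "\<And>i j. (i, j) \<in> E \<Longrightarrow> a \<le> A $ i $ j"
      and hi: "\<And>i j. A $ i $ j \<le> b" and w: "positive_eigenpair A w l"
    note wpos = positive_eigenpairD(1)[OF w] note A0 = pos_edge_funs_nonneg[OF A]
    define m where "m = Max (range (\<lambda>i. w $ i))"
    have m: "w $ i \<le> m" for i unfolding m_def by (intro Max_ge) auto
    have "m \<in> range (\<lambda>i. w $ i)" unfolding m_def by (intro Max_in) auto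
    then obtain k where k: "m = w $ k" by auto
    have b: "0 \<le> b" using A0 hi by (meson order_trans)
    have "l * m = (\<Sum>j\<in>UNIV. A $ k $ j * w $ j)" using positive_eigenpairD(2)[OF w] k by simp
    also have "\<dots> \<le> (\<Sum>j::'n\<in>UNIV. b * m)"
      using hi m wpos b by (intro sum_mono mult_mono) (auto intro: less_imp_le)
    also have "\<dots> = (real CARD('n) * b) * m" by simp
    finally have lb: "l \<le> real CARD('n) * b" using k wpos[of k] by simp
    have "w $ j \<le> c * w $ i" if ij: "(i, j) \<in> E" for i j
    proof -
      have "a * w $ j \<le> A $ i $ j * w $ j" using lo[OF ij] wpos[of j] by simp
      also have "\<dots> \<le> (\<Sum>j\<in>UNIV. A $ i $ j * w $ j)"
        using A0 wpos by (intro member_le_sum) (auto intro!: mult_nonneg_nonneg simp: less_imp_le)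
      also have "\<dots> = l * w $ i" by (rule positive_eigenpairD(2)[OF w])
      also have "\<dots> \<le> (real CARD('n) * b) * w $ i"
        using lb wpos[of i] by (intro mult_right_mono) auto
      finally show ?thesis using a by (simp add: c_def field_simps)
    qed
    thus "w $ j \<le> C * w $ i" using C[of "\<lambda>i. w $ i"] wpos by blast
  qed
qed

section \<open>Entrywise logarithms and the normalization\<close>

lemma exp_on_pos: "exp_on E u \<in> pos_edge_funs E"
  by (auto simp: exp_on_def pos_edge_funs_def edge_funs_def)

lemma exp_on_edge: "exp_on E u \<in> edge_funs E"
  by (simp add: exp_on_def edge_funs_def)

lemma exp_log_on: "F \<in> pos_edge_funs E \<Longrightarrow> exp_on E (log_on E F) = F"
  by (auto simp: exp_on_def log_on_def pos_edge_funs_def edge_funs_def vec_eq_iff)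

lemma log_exp_on: "u \<in> edge_funs E \<Longrightarrow> log_on E (exp_on E u) = u"
  by (auto simp: exp_on_def log_on_def edge_funs_def vec_eq_iff)

lemma log_on_edge: "log_on E F \<in> edge_funs E"
  by (auto simp: log_on_def edge_funs_def)

definition grad_on :: "('y::finite) rel \<Rightarrow> real ^ 'y \<Rightarrow> 'y rmatrix" where
  "grad_on E f = (\<chi> y y'. if (y, y') \<in> E then f $ y' - f $ y else 0)"

definition const_on :: "('y::finite) rel \<Rightarrow> real \<Rightarrow> 'y rmatrix" where
  "const_on E c = (\<chi> y y'. if (y, y') \<in> E then c else 0)"

lemma null_space_eq: "null_space E = {grad_on E f + const_on E c | f c. True}"
proof -
  have "(\<chi> y y'. if (y, y') \<in> E then f y' - f y + c else 0) = grad_on E (\<chi> y. f y) + const_on E c" for f c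
    by (auto simp: grad_on_def const_on_def vec_eq_iff)
  moreover have "grad_on E f + const_on E c = (\<chi> y y'. if (y, y') \<in> E then f $ y' - f $ y + c else 0)" for f c
    by (auto simp: grad_on_def const_on_def vec_eq_iff)
  ultimately show ?thesis unfolding null_space_def by blast
qed

lemma grad_on_linear: "linear (grad_on E)"
  by (rule linearI) (auto simp: grad_on_def vec_eq_iff algebra_simps)

lemma const_on_linear: "linear (const_on E)"
  by (rule linearI) (auto simp: const_on_def vec_eq_iff algebra_simps)

lemma subspace_edge_funs: "subspace (edge_funs E)"
  by (auto simp: subspace_def edge_funs_def)

lemma grad_on_edge: "grad_on E f \<in> edge_funs E"
  by (auto simp: grad_on_def edge_funs_def)

lemma subspace_null_space: "subspace (null_space E)"
proof -
  have "null_space E = {x + y |x y. x \<in> range (grad_on E) \<and> y \<in> range (const_on E)}"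
    by (auto simp: null_space_eq)
  also have "subspace \<dots>"
    by (intro subspace_sums linear_subspace_image grad_on_linear const_on_linear subspace_UNIV)
  finally show ?thesis .
qed

lemma stoch_normalize_stochastic:
  assumes E: "E \<noteq> {}" "strongly_connected_rel E" and A: "A \<in> pos_edge_funs E"
  shows "stoch_normalize A \<in> stochastic_mats E"
proof -
  obtain v l where v: "positive_eigenpair A v l" by (rule positive_eigenpair_exists[OF E A])
  have l: "l > 0" by (rule eigenvalue_pos[OF E A v])
  note vpos = positive_eigenpairD(1)[OF v]
  have "(\<Sum>j\<in>UNIV. A $ i $ j * v $ j / (l * v $ i)) = 1" for i
    using positive_eigenpairD(2)[OF v, of i] l vpos[of i] by (simp flip: sum_divide_distrib)
  thus ?thesis
    using A l vpos
    by (auto simp: stoch_normalize_eq[OF E A v] stochastic_mats_def pos_edge_funs_def edge_funs_def)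
qed

text \<open>
  On the logarithmic scale, normalization is a translation by an element of the null space, with
  potential the logarithm of the eigenvector and constant minus the logarithm of the root.
\<close>

lemma log_stoch_normalize:
  assumes E: "E \<noteq> {}" "strongly_connected_rel E" and A: "A \<in> pos_edge_funs E"
  obtains n where "n \<in> null_space E" "log_on E (stoch_normalize A) = log_on E A + n"
proof -
  obtain v l where v: "positive_eigenpair A v l" by (rule positive_eigenpair_exists[OF E A])
  have l: "l > 0" by (rule eigenvalue_pos[OF E A v])
  note vpos = positive_eigenpairD(1)[OF v]
  have nz: "v $ i \<noteq> 0" "(i, j) \<in> E \<Longrightarrow> A $ i $ j \<noteq> 0" for i j
    using vpos[of i] pos_edge_funs_pos[OF A, of i j] by auto
  have "log_on E (stoch_normalize A) = log_on E A + (grad_on E (\<chi> i. ln (v $ i)) + const_on E (- ln l))"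
    using l vpos pos_edge_funs_pos[OF A]
    by (auto simp: stoch_normalize_eq[OF E A v] log_on_def grad_on_def const_on_def vec_eq_iff
        ln_mult_pos ln_div nz)
  thus thesis by (intro that) (auto simp: null_space_eq)
qed

text \<open>
  Adding \<open>f(y') - f(y) + c\<close> to the logarithm conjugates the matrix by a positive diagonal matrix and
  rescales it; the eigenvector changes by the factor \<open>exp (- f)\<close> and the root by \<open>exp c\<close>, so the
  normalized matrix is the same.
\<close>

lemma stoch_normalize_add_null:
  assumes E: "E \<noteq> {}" "strongly_connected_rel E" and n: "n \<in> null_space E"
  shows "stoch_normalize (exp_on E (u + n)) = stoch_normalize (exp_on E u)"
proof -
  note A = exp_on_pos[of E u]
  obtain v l where v: "positive_eigenpair (exp_on E u) v l" by (rule positive_eigenpair_exists[OF E A])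
  have l: "l > 0" by (rule eigenvalue_pos[OF E A v])
  note vpos = positive_eigenpairD(1)[OF v]
  obtain f c where n: "n = grad_on E f + const_on E c" using n by (auto simp: null_space_eq)
  define w where "w = (\<chi> i. v $ i * exp (- f $ i))"
  have eq: "exp_on E (u + n) $ i $ j = exp_on E u $ i $ j * exp (f $ j - f $ i + c)" for i j
    by (auto simp: exp_on_def n grad_on_def const_on_def simp flip: exp_add)
  have "positive_eigenpair (exp_on E (u + n)) w (l * exp c)"
    unfolding positive_eigenpair_def
  proof (intro conjI allI)
    fix i
    have "(\<Sum>j\<in>UNIV. exp_on E (u + n) $ i $ j * w $ j) = (\<Sum>j\<in>UNIV. exp_on E u $ i $ j * v $ j * exp (c - f $ i))"
    proof (intro sum.cong refl)
      fix j
      have "exp (f $ j - f $ i + c) * exp (- f $ j) = exp (c - f $ i)" by (simp flip: exp_add)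
      thus "exp_on E (u + n) $ i $ j * w $ j = exp_on E u $ i $ j * v $ j * exp (c - f $ i)"
        by (simp only: eq w_def vec_lambda_beta) (metis mult.assoc mult.commute)
    qed
    also have "\<dots> = l * v $ i * exp (c - f $ i)"
      by (simp only: positive_eigenpairD(2)[OF v] flip: sum_distrib_right)
    also have "\<dots> = l * exp c * w $ i"
      by (simp add: w_def exp_diff exp_minus field_simps)
    finally show "(\<Sum>j\<in>UNIV. exp_on E (u + n) $ i $ j * w $ j) = l * exp c * w $ i" .
  qed (use vpos in \<open>simp add: w_def\<close>)
  note norm = stoch_normalize_eq[OF E exp_on_pos this]
  have "exp_on E (u + n) $ i $ j * w $ j / (l * exp c * w $ i) = exp_on E u $ i $ j * v $ j / (l * v $ i)" for i j
    unfolding eq w_def using l vpos[of i] by (simp add: exp_add exp_diff exp_minus divide_simps)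
  thus ?thesis unfolding norm stoch_normalize_eq[OF E A v] by simp
qed

lemma stoch_normalize_stochastic_id:
  assumes E: "E \<noteq> {}" "strongly_connected_rel E" and W: "W \<in> stochastic_mats E"
  shows "stoch_normalize W = W"
proof -
  have A: "W \<in> pos_edge_funs E" using W by (simp add: stochastic_mats_def)
  have "positive_eigenpair W (\<chi> i. 1) 1"
    using W by (simp add: positive_eigenpair_def stochastic_mats_def)
  from stoch_normalize_eq[OF E A this] show ?thesis by (simp add: vec_eq_iff)
qed

section \<open>Lumpable matrices\<close>

definition lumpable_edge_funs :: "('y::finite \<Rightarrow> 'x) \<Rightarrow> 'y rel \<Rightarrow> 'y rmatrix set" where
  "lumpable_edge_funs \<kappa> E = {F \<in> edge_funs E. lumpable \<kappa> E F}"

definition lumped :: "('y::finite \<Rightarrow> 'x::finite) \<Rightarrow> 'y rel \<Rightarrow> 'y rmatrix \<Rightarrow> 'x rmatrix" where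
  "lumped \<kappa> E F = (\<chi> x x'. if (x, x') \<in> lumped_edges \<kappa> E then row_mass F (inv \<kappa> x) (fiber \<kappa> x') else 0)"

definition section_null :: "('y::finite \<Rightarrow> 'x::finite) \<Rightarrow> (real ^ 'y) set" where
  "section_null \<kappa> = {f. \<forall>x. f $ inv \<kappa> x = 0}"

text \<open>
  The logarithms of matrices that are diagonally conjugate to a positive lumpable one, where the diagonal
  factor \<open>exp f\<close> is normalized to be \<open>1\<close> at the representative \<open>inv \<kappa> x\<close> of each fiber. Only this
  normalization makes \<open>f\<close> unique, since a factor that is constant on fibers preserves lumpability.
\<close>

definition gauge_lumpable :: "('y::finite \<Rightarrow> 'x::finite) \<Rightarrow> 'y rel \<Rightarrow> 'y rmatrix set" where
  "gauge_lumpable \<kappa> E = {u \<in> edge_funs E. \<exists>f\<in>section_null \<kappa>. lumpable \<kappa> E (exp_on E (u - grad_on E f))}"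

lemma lumpable_iff:
  "lumpable \<kappa> E F \<longleftrightarrow> (\<forall>y z x'. \<kappa> y = \<kappa> z \<longrightarrow> (\<kappa> y, x') \<in> lumped_edges \<kappa> E \<longrightarrow>
     row_mass F y (fiber \<kappa> x') = row_mass F z (fiber \<kappa> x'))"
proof
  assume L: "lumpable \<kappa> E F"
  show "\<forall>y z x'. \<kappa> y = \<kappa> z \<longrightarrow> (\<kappa> y, x') \<in> lumped_edges \<kappa> E \<longrightarrow>
     row_mass F y (fiber \<kappa> x') = row_mass F z (fiber \<kappa> x')"
  proof (intro allI impI)
    fix y z x' assume "\<kappa> y = \<kappa> z" and D: "(\<kappa> y, x') \<in> lumped_edges \<kappa> E"
    hence "y \<in> fiber \<kappa> (\<kappa> y)" "z \<in> fiber \<kappa> (\<kappa> y)" by (auto simp: fiber_def)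
    with bspec[OF L[unfolded lumpable_def] D, unfolded prod.case]
    show "row_mass F y (fiber \<kappa> x') = row_mass F z (fiber \<kappa> x')" by blast
  qed
next
  assume R: "\<forall>y z x'. \<kappa> y = \<kappa> z \<longrightarrow> (\<kappa> y, x') \<in> lumped_edges \<kappa> E \<longrightarrow>
     row_mass F y (fiber \<kappa> x') = row_mass F z (fiber \<kappa> x')"
  show "lumpable \<kappa> E F"
    unfolding lumpable_def
  proof (safe)
    fix x x' y z assume "(x, x') \<in> lumped_edges \<kappa> E" "y \<in> fiber \<kappa> x" "z \<in> fiber \<kappa> x"
    thus "row_mass F y (fiber \<kappa> x') = row_mass F z (fiber \<kappa> x')"
      using R[rule_format, of y z x'] by (simp add: fiber_def)
  qed
qed

lemma row_mass_add: "row_mass (F + G) y S = row_mass F y S + row_mass G y S"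
  by (simp add: row_mass_def sum.distrib)

lemma row_mass_scale: "row_mass (c *\<^sub>R F) y S = c * row_mass F y S"
  by (simp add: row_mass_def sum_distrib_left)

lemma subspace_lumpable_edge_funs: "subspace (lumpable_edge_funs \<kappa> E)"
proof -
  have "lumpable \<kappa> E (F + G)" if "lumpable \<kappa> E F" "lumpable \<kappa> E G" for F G
    using that unfolding lumpable_iff row_mass_add by metis
  moreover have "lumpable \<kappa> E (c *\<^sub>R F)" if "lumpable \<kappa> E F" for F c
    using that unfolding lumpable_iff row_mass_scale by metis
  moreover have "lumpable \<kappa> E 0" by (simp add: lumpable_iff row_mass_def)
  ultimately show ?thesis
    using subspace_edge_funs[of E] by (auto simp: subspace_def lumpable_edge_funs_def)
qed

lemma subspace_section_null: "subspace (section_null \<kappa>)"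
  by (auto simp: subspace_def section_null_def)

lemma lumpable_pos_edge_funs_eq: "lumpable_pos_edge_funs \<kappa> E = pos_edge_funs E \<inter> lumpable_edge_funs \<kappa> E"
  by (auto simp: lumpable_pos_edge_funs_def lumpable_edge_funs_def pos_edge_funs_def)

lemma row_mass_lumped:
  assumes F: "F \<in> lumpable_edge_funs \<kappa> E" and \<kappa>: "surj \<kappa>"
  shows "row_mass F y (fiber \<kappa> x') = lumped \<kappa> E F $ \<kappa> y $ x'"
proof (cases "(\<kappa> y, x') \<in> lumped_edges \<kappa> E")
  case True
  have "\<kappa> y = \<kappa> (inv \<kappa> (\<kappa> y))" by (simp add: surj_f_inv_f[OF \<kappa>])
  moreover have "lumpable \<kappa> E F" using F by (simp add: lumpable_edge_funs_def)
  ultimately have "row_mass F y (fiber \<kappa> x') = row_mass F (inv \<kappa> (\<kappa> y)) (fiber \<kappa> x')"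
    using True unfolding lumpable_iff by blast
  thus ?thesis using True by (simp add: lumped_def)
next
  case False
  hence "F $ y $ y' = 0" if "y' \<in> fiber \<kappa> x'" for y'
    using that F by (auto simp: lumpable_edge_funs_def edge_funs_def lumped_edges_def fiber_def)
  thus ?thesis using False by (simp add: lumped_def row_mass_def)
qed

lemma lumpableI:
  assumes "\<And>y x'. row_mass F y (fiber \<kappa> x') = H (\<kappa> y) x'"
  shows "lumpable \<kappa> E F"
  using assms by (simp add: lumpable_iff)

text \<open>
  Lumpability is preserved by factors that depend on the lumped states only. In particular,
  \<^const>\<open>log_lumpable\<close> is stable under adding lumped potentials and constants.
\<close>

lemma scale_lumpable:
  fixes \<kappa> :: "'y::finite \<Rightarrow> 'x::finite"
  assumes F: "F \<in> lumpable_pos_edge_funs \<kappa> E" and \<kappa>: "surj \<kappa>" and H: "\<And>x x'. 0 < H x x'"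
  shows "(\<chi> y y'. F $ y $ y' * H (\<kappa> y) (\<kappa> y')) \<in> lumpable_pos_edge_funs \<kappa> E"
proof -
  have F': "F \<in> lumpable_edge_funs \<kappa> E" "F \<in> pos_edge_funs E" using F by (auto simp: lumpable_pos_edge_funs_eq)
  have "row_mass (\<chi> y y'. F $ y $ y' * H (\<kappa> y) (\<kappa> y')) y (fiber \<kappa> x')
      = lumped \<kappa> E F $ \<kappa> y $ x' * H (\<kappa> y) x'" for y x'
    unfolding row_mass_lumped[OF F'(1) \<kappa>, symmetric] row_mass_def sum_distrib_right
    by (intro sum.cong) (auto simp: fiber_def)
  hence "lumpable \<kappa> E (\<chi> y y'. F $ y $ y' * H (\<kappa> y) (\<kappa> y'))" by (rule lumpableI)
  thus ?thesis using F'(2) H by (auto simp: lumpable_pos_edge_funs_def pos_edge_funs_def edge_funs_def)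
qed

lemma sum_fibers:
  fixes \<kappa> :: "'y::finite \<Rightarrow> 'x::finite"
  shows "(\<Sum>y\<in>UNIV. g y) = (\<Sum>x\<in>UNIV. \<Sum>y\<in>fiber \<kappa> x. (g y :: real))"
  using sum.group[of UNIV UNIV \<kappa> g] by (simp add: fiber_def vimage_def)

lemma strongly_connected_lumped:
  fixes \<kappa> :: "'y::finite \<Rightarrow> 'x::finite"
  assumes E: "strongly_connected_rel E" and \<kappa>: "surj \<kappa>"
  shows "strongly_connected_rel (lumped_edges \<kappa> E)"
  unfolding strongly_connected_rel_def
proof (intro allI)
  fix x x'
  have "(inv \<kappa> x, inv \<kappa> x') \<in> E\<^sup>*" using E by (auto simp: strongly_connected_rel_def)
  hence "(\<kappa> (inv \<kappa> x), \<kappa> (inv \<kappa> x')) \<in> (lumped_edges \<kappa> E)\<^sup>*"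
    by (induction rule: rtrancl_induct) (auto simp: lumped_edges_def intro: rtrancl_into_rtrancl)
  thus "(x, x') \<in> (lumped_edges \<kappa> E)\<^sup>*" by (simp add: surj_f_inv_f[OF \<kappa>])
qed

lemma row_mass_pos:
  assumes "F \<in> pos_edge_funs E" "(y, y') \<in> E" "\<kappa> y' = x'"
  shows "0 < row_mass F y (fiber \<kappa> x')"
proof -
  have "0 < F $ y $ y'" using assms by (auto simp: pos_edge_funs_pos)
  also have "\<dots> \<le> row_mass F y (fiber \<kappa> x')"
    unfolding row_mass_def using assms pos_edge_funs_nonneg[OF assms(1)]
    by (intro member_le_sum) (auto simp: fiber_def)
  finally show ?thesis .
qed

lemma lumped_pos:
  fixes \<kappa> :: "'y::finite \<Rightarrow> 'x::finite"
  assumes F: "F \<in> lumpable_pos_edge_funs \<kappa> E" and \<kappa>: "surj \<kappa>"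
  shows "lumped \<kappa> E F \<in> pos_edge_funs (lumped_edges \<kappa> E)"
proof -
  have F': "F \<in> lumpable_edge_funs \<kappa> E" "F \<in> pos_edge_funs E" using F by (auto simp: lumpable_pos_edge_funs_eq)
  have "0 < lumped \<kappa> E F $ \<kappa> y $ \<kappa> y'" if "(y, y') \<in> E" for y y'
    using row_mass_pos[OF F'(2) that refl, of \<kappa>] by (simp add: row_mass_lumped[OF F'(1) \<kappa>])
  moreover have "lumped \<kappa> E F \<in> edge_funs (lumped_edges \<kappa> E)" by (simp add: lumped_def edge_funs_def)
  ultimately show ?thesis by (force simp: pos_edge_funs_def lumped_edges_def)
qed

text \<open>
  The positive eigenvector of the lumped matrix, pulled back along \<open>\<kappa>\<close>, is one of \<open>F\<close>: the
  eigenvalue equation at \<open>y\<close> only sees the row masses on fibers.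
\<close>

lemma lumped_eigenpair:
  fixes \<kappa> :: "'y::finite \<Rightarrow> 'x::finite"
  assumes E: "E \<noteq> {}" "strongly_connected_rel E" and \<kappa>: "surj \<kappa>"
    and F: "F \<in> lumpable_pos_edge_funs \<kappa> E"
  obtains v l where "positive_eigenpair F (\<chi> y. v $ \<kappa> y) l"
proof -
  have F': "F \<in> lumpable_edge_funs \<kappa> E" using F by (auto simp: lumpable_pos_edge_funs_eq)
  have "lumped_edges \<kappa> E \<noteq> {}" using E(1) by (auto simp: lumped_edges_def)
  then obtain v l where v: "positive_eigenpair (lumped \<kappa> E F) v l"
    using positive_eigenpair_exists strongly_connected_lumped[OF E(2) \<kappa>] lumped_pos[OF F \<kappa>] by metis
  have "(\<Sum>y'\<in>UNIV. F $ y $ y' * v $ \<kappa> y') = l * v $ \<kappa> y" for y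
  proof -
    have "(\<Sum>y'\<in>UNIV. F $ y $ y' * v $ \<kappa> y') = (\<Sum>x'\<in>UNIV. row_mass F y (fiber \<kappa> x') * v $ x')"
      unfolding row_mass_def sum_distrib_right
      by (subst sum_fibers[of _ \<kappa>]) (auto intro!: sum.cong simp: fiber_def)
    thus ?thesis by (simp add: row_mass_lumped[OF F' \<kappa>] positive_eigenpairD(2)[OF v])
  qed
  thus thesis using positive_eigenpairD(1)[OF v] by (intro that[of v l]) (auto simp: positive_eigenpair_def)
qed

text \<open>
  The eigenvector being constant on fibers, normalization multiplies the entries by a factor that
  depends on the lumped states only.
\<close>

lemma stoch_normalize_lumpable:
  fixes \<kappa> :: "'y::finite \<Rightarrow> 'x::finite"
  assumes E: "E \<noteq> {}" "strongly_connected_rel E" and \<kappa>: "surj \<kappa>"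
    and F: "F \<in> lumpable_pos_edge_funs \<kappa> E"
  shows "stoch_normalize F \<in> lumpable_stochastic_mats \<kappa> E"
proof -
  have F': "F \<in> pos_edge_funs E" using F by (auto simp: lumpable_pos_edge_funs_eq)
  obtain v l where v: "positive_eigenpair F (\<chi> y. v $ \<kappa> y) l" by (rule lumped_eigenpair[OF E \<kappa> F])
  have vpos: "0 < v $ x" for x
    using positive_eigenpairD(1)[OF v, of "inv \<kappa> x"] by (simp add: surj_f_inv_f[OF \<kappa>])
  have l: "0 < l" by (rule eigenvalue_pos[OF E F' v])
  have "stoch_normalize F = (\<chi> y y'. F $ y $ y' * (\<lambda>x x'. v $ x' / (l * v $ x)) (\<kappa> y) (\<kappa> y'))"
    by (simp add: stoch_normalize_eq[OF E F' v])
  also have "\<dots> \<in> lumpable_pos_edge_funs \<kappa> E"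
    by (rule scale_lumpable[OF F \<kappa>]) (use vpos l in auto)
  finally show ?thesis
    using stoch_normalize_stochastic[OF E F']
    by (auto simp: lumpable_stochastic_mats_def lumpable_pos_edge_funs_def)
qed

text \<open>
  A potential \<open>f\<close> splits into a part pulled back from the lumped states, which together with the
  constant is absorbed into the lumpable matrix, and a part vanishing at the representatives.
\<close>

lemma gauge_lumpable_eq_sum:
  fixes \<kappa> :: "'y::finite \<Rightarrow> 'x::finite"
  assumes \<kappa>: "surj \<kappa>"
  shows "gauge_lumpable \<kappa> E = log_lumpable \<kappa> E + null_space E"
proof (intro equalityI subsetI)
  fix u assume "u \<in> gauge_lumpable \<kappa> E"
  then obtain f where u: "u \<in> edge_funs E" and f: "lumpable \<kappa> E (exp_on E (u - grad_on E f))"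
    by (auto simp: gauge_lumpable_def)
  have "u - grad_on E f = log_on E (exp_on E (u - grad_on E f))"
    using u grad_on_edge subspace_diff[OF subspace_edge_funs] by (metis log_exp_on)
  hence "u - grad_on E f \<in> log_lumpable \<kappa> E"
    using f exp_on_pos by (auto simp: log_lumpable_def lumpable_pos_edge_funs_def)
  moreover have "grad_on E f \<in> null_space E"
  proof -
    have "grad_on E f = grad_on E f + const_on E 0" by (simp add: linear_0[OF const_on_linear])
    thus ?thesis unfolding null_space_eq by blast
  qed
  ultimately show "u \<in> log_lumpable \<kappa> E + null_space E"
    by (metis diff_add_cancel set_plus_intro)
next
  fix u assume "u \<in> log_lumpable \<kappa> E + null_space E"
  then obtain F f c where F: "F \<in> lumpable_pos_edge_funs \<kappa> E" and u: "u = log_on E F + (grad_on E f + const_on E c)"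
    by (auto simp: set_plus_def log_lumpable_def null_space_eq)
  have F': "F \<in> pos_edge_funs E" using F by (simp add: lumpable_pos_edge_funs_eq)
  \<comment> \<open>The pulled back part of the potential takes the value of f at the representative on the whole fiber.\<close>
  define g where "g = (\<chi> y. f $ y - f $ inv \<kappa> (\<kappa> y))"
  have g: "g \<in> section_null \<kappa>" by (simp add: g_def section_null_def surj_f_inv_f[OF \<kappa>])
  have "exp_on E (u - grad_on E g) = (\<chi> y y'. F $ y $ y' * (\<lambda>x x'. exp (f $ inv \<kappa> x' - f $ inv \<kappa> x + c)) (\<kappa> y) (\<kappa> y'))"
    using F' by (auto simp: exp_on_def u log_on_def grad_on_def const_on_def g_def vec_eq_iff
        pos_edge_funs_def edge_funs_def exp_add exp_diff field_simps)
  also have "\<dots> \<in> lumpable_pos_edge_funs \<kappa> E" by (rule scale_lumpable[OF F \<kappa>]) auto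
  finally have "lumpable \<kappa> E (exp_on E (u - grad_on E g))" by (simp add: lumpable_pos_edge_funs_def)
  moreover have "u \<in> edge_funs E"
    by (auto simp: u edge_funs_def log_on_def grad_on_def const_on_def)
  ultimately show "u \<in> gauge_lumpable \<kappa> E" using g by (auto simp: gauge_lumpable_def)
qed

section \<open>Uniqueness and compactness of the gauge\<close>

text \<open>
  Undoing the conjugation: the pulled back eigenvector of the lumpable matrix becomes the eigenvector
  \<open>v(\<kappa> y) exp (- f y)\<close> of \<open>exp u\<close>. So within each fiber the potential \<open>f\<close> is determined, and
  controlled, by the Perron--Frobenius eigenvector of \<open>exp u\<close>.
\<close>

lemma gauge_eigenpair:
  fixes \<kappa> :: "'y::finite \<Rightarrow> 'x::finite"
  assumes E: "E \<noteq> {}" "strongly_connected_rel E" and \<kappa>: "surj \<kappa>"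
    and f: "lumpable \<kappa> E (exp_on E (u - grad_on E f))"
  obtains v l where "positive_eigenpair (exp_on E u) (\<chi> y. v $ \<kappa> y * exp (- f $ y)) l" "\<And>x. 0 < v $ x"
proof -
  have "exp_on E (u - grad_on E f) \<in> lumpable_pos_edge_funs \<kappa> E"
    using f by (simp add: lumpable_pos_edge_funs_def exp_on_pos)
  then obtain v l where v: "positive_eigenpair (exp_on E (u - grad_on E f)) (\<chi> y. v $ \<kappa> y) l"
    by (rule lumped_eigenpair[OF E \<kappa>])
  have vpos: "0 < v $ x" for x
    using positive_eigenpairD(1)[OF v, of "inv \<kappa> x"] by (simp add: surj_f_inv_f[OF \<kappa>])
  have "(\<Sum>y'\<in>UNIV. exp_on E u $ y $ y' * (v $ \<kappa> y' * exp (- f $ y'))) = l * (v $ \<kappa> y * exp (- f $ y))" for y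
  proof -
    have "(\<Sum>y'\<in>UNIV. exp_on E u $ y $ y' * (v $ \<kappa> y' * exp (- f $ y')))
        = (\<Sum>y'\<in>UNIV. exp_on E (u - grad_on E f) $ y $ y' * v $ \<kappa> y' * exp (- f $ y))"
      by (intro sum.cong refl) (auto simp: exp_on_def grad_on_def exp_add exp_diff exp_minus field_simps)
    thus ?thesis using positive_eigenpairD(2)[OF v, of y] by (simp flip: sum_distrib_right)
  qed
  thus thesis using vpos by (intro that[of v l]) (auto simp: positive_eigenpair_def)
qed

text \<open>
  Two potentials give two proportional eigenvectors of \<open>exp u\<close>. Comparison at the representatives,
  where both potentials vanish, shows that the pulled back factors are already proportional.
\<close>

lemma gauge_unique:
  fixes \<kappa> :: "'y::finite \<Rightarrow> 'x::finite"
  assumes E: "E \<noteq> {}" "strongly_connected_rel E" and \<kappa>: "surj \<kappa>"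
    and f: "f \<in> section_null \<kappa>" "lumpable \<kappa> E (exp_on E (u - grad_on E f))"
    and g: "g \<in> section_null \<kappa>" "lumpable \<kappa> E (exp_on E (u - grad_on E g))"
  shows "f = g"
proof -
  obtain v l where v: "positive_eigenpair (exp_on E u) (\<chi> y. v $ \<kappa> y * exp (- f $ y)) l" "\<And>x. 0 < v $ x"
    using gauge_eigenpair[OF E \<kappa> f(2)] by metis
  obtain w m where w: "positive_eigenpair (exp_on E u) (\<chi> y. w $ \<kappa> y * exp (- g $ y)) m" "\<And>x. 0 < w $ x"
    using gauge_eigenpair[OF E \<kappa> g(2)] by metis
  obtain c where c: "c > 0" "\<And>y. w $ \<kappa> y * exp (- g $ y) = c * (v $ \<kappa> y * exp (- f $ y))"
    using positive_eigenvector_unique[OF E(2) exp_on_pos v(1) w(1)] by auto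
  have "f $ y = g $ y" for y
  proof -
    have "w $ \<kappa> y = c * v $ \<kappa> y"
      using c(2)[of "inv \<kappa> (\<kappa> y)"] f(1) g(1) by (simp add: section_null_def surj_f_inv_f[OF \<kappa>])
    hence "exp (- g $ y) = exp (- f $ y)"
      using c(1) c(2)[of y] v(2)[of "\<kappa> y"] by simp
    thus ?thesis by simp
  qed
  thus ?thesis by (simp add: vec_eq_iff)
qed

text \<open>
  The eigenvector ratios within a fiber are \<open>exp (- f)\<close> and its inverse, and these are bounded as long
  as \<open>u\<close> stays bounded.
\<close>

lemma gauge_bounded:
  fixes \<kappa> :: "'y::finite \<Rightarrow> 'x::finite"
  assumes E: "E \<noteq> {}" "strongly_connected_rel E" and \<kappa>: "surj \<kappa>"
  obtains M where "\<And>u f. norm u \<le> r \<Longrightarrow> f \<in> section_null \<kappa> \<Longrightarrow>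
      lumpable \<kappa> E (exp_on E (u - grad_on E f)) \<Longrightarrow> norm f \<le> M"
proof -
  obtain C where C: "\<And>A w l i j. A \<in> pos_edge_funs E \<Longrightarrow> (\<And>i j. (i, j) \<in> E \<Longrightarrow> exp (- r) \<le> A $ i $ j) \<Longrightarrow>
     (\<And>i j. A $ i $ j \<le> exp r) \<Longrightarrow> positive_eigenpair A w l \<Longrightarrow> w $ j \<le> C * w $ i"
    using eigenvector_harnack[OF E(2), of "exp (- r)" "exp r"] by (metis exp_gt_zero)
  have "norm f \<le> real CARD('y) * ln C"
    if u: "norm u \<le> r" and f: "f \<in> section_null \<kappa>" "lumpable \<kappa> E (exp_on E (u - grad_on E f))" for u f
  proof -
    have "\<bar>u $ i $ j\<bar> \<le> r" for i j
      using component_le_norm_cart[of "u $ i" j] Finite_Cartesian_Product.norm_nth_le[of u i] u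
      by simp
    hence b: "- r \<le> u $ i $ j" "u $ i $ j \<le> r" for i j by (auto simp: abs_le_iff minus_le_iff)
    obtain v l where v: "positive_eigenpair (exp_on E u) (\<chi> y. v $ \<kappa> y * exp (- f $ y)) l" "\<And>x. 0 < v $ x"
      using gauge_eigenpair[OF E \<kappa> f(2)] by metis
    have H: "v $ \<kappa> j * exp (- f $ j) \<le> C * (v $ \<kappa> i * exp (- f $ i))" for i j
      using C[OF exp_on_pos _ _ v(1), of j i] b by (auto simp: exp_on_def)
    have "\<bar>f $ y\<bar> \<le> ln C" for y
    proof -
      have "exp (- f $ y) \<le> C" "1 \<le> C * exp (- f $ y)"
        using H[of y "inv \<kappa> (\<kappa> y)"] H[of "inv \<kappa> (\<kappa> y)" y] f(1) v(2)[of "\<kappa> y"]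
        by (simp_all add: section_null_def surj_f_inv_f[OF \<kappa>])
      moreover from this(1) have "0 < C" by (meson exp_gt_zero less_le_trans)
      ultimately have "- f $ y \<le> ln C" "exp (f $ y) \<le> C"
        by (auto simp: ln_ge_iff exp_minus field_simps)
      thus ?thesis using \<open>0 < C\<close> by (simp add: ln_ge_iff abs_le_iff)
    qed
    thus ?thesis
      using norm_le_l1_cart[of f] sum_bounded_above[of UNIV "\<lambda>y. \<bar>f $ y\<bar>" "ln C"] by fastforce
  qed
  thus thesis by (rule that)
qed

text \<open>
  The graph of the map sending \<open>u\<close> to its potential, over a ball. Its compactness replaces any
  discussion of how the root and the eigenvector depend on the matrix.
\<close>

definition gauge_pairs :: "('y::finite \<Rightarrow> 'x::finite) \<Rightarrow> 'y rel \<Rightarrow> real \<Rightarrow> ('y rmatrix \<times> (real ^ 'y)) set" where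
  "gauge_pairs \<kappa> E r = {(u, f). u \<in> edge_funs E \<and> norm u \<le> r \<and> f \<in> section_null \<kappa> \<and>
     lumpable \<kappa> E (exp_on E (u - grad_on E f))}"

lemma continuous_exp_grad: "continuous_on A (\<lambda>(u, f). exp_on E (u - grad_on E f))"
proof -
  have eq: "(if b then x else (0::real)) = (if b then 1 else 0) * x" for b x by simp
  show ?thesis unfolding exp_on_def grad_on_def case_prod_unfold
    by (subst (1 2) eq) (intro continuous_intros)
qed

lemma compact_gauge_pairs:
  fixes \<kappa> :: "'y::finite \<Rightarrow> 'x::finite"
  assumes E: "E \<noteq> {}" "strongly_connected_rel E" and \<kappa>: "surj \<kappa>"
  shows "compact (gauge_pairs \<kappa> E r)"
proof -
  define h where "h = (\<lambda>(u, f). exp_on E (u - grad_on E f))"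
  obtain M where M: "\<And>u f. norm u \<le> r \<Longrightarrow> f \<in> section_null \<kappa> \<Longrightarrow>
      lumpable \<kappa> E (exp_on E (u - grad_on E f)) \<Longrightarrow> norm f \<le> M"
    using gauge_bounded[OF E \<kappa>] by metis
  have eq: "gauge_pairs \<kappa> E r = ((edge_funs E \<inter> cball 0 r) \<times> (section_null \<kappa> \<inter> cball 0 M)) \<inter> h -` lumpable_edge_funs \<kappa> E"
    using M exp_on_edge by (auto simp: gauge_pairs_def h_def lumpable_edge_funs_def)
  have "continuous_on UNIV h" unfolding h_def by (rule continuous_exp_grad)
  hence "closed (h -` lumpable_edge_funs \<kappa> E)"
    by (intro closed_vimage closed_subspace subspace_lumpable_edge_funs)
  moreover have "compact (edge_funs E \<inter> cball 0 r)" "compact (section_null \<kappa> \<inter> cball 0 M)"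
    by (intro closed_Int_compact closed_subspace subspace_edge_funs subspace_section_null compact_cball)+
  ultimately show ?thesis unfolding eq by (blast intro: compact_Int_closed compact_Times)
qed

definition section_gauge :: "('y::finite \<Rightarrow> 'x::finite) \<Rightarrow> 'y rel \<Rightarrow> 'y rmatrix \<Rightarrow> real ^ 'y" where
  "section_gauge \<kappa> E u = (THE f. f \<in> section_null \<kappa> \<and> lumpable \<kappa> E (exp_on E (u - grad_on E f)))"

lemma fst_gauge_pairs: "fst ` gauge_pairs \<kappa> E r = gauge_lumpable \<kappa> E \<inter> cball 0 r"
  by (force simp: gauge_pairs_def gauge_lumpable_def)

text \<open>
  Over each closed ball the set is the projection of a compact graph.
\<close>

lemma closed_gauge_lumpable:
  fixes \<kappa> :: "'y::finite \<Rightarrow> 'x::finite"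
  assumes E: "E \<noteq> {}" "strongly_connected_rel E" and \<kappa>: "surj \<kappa>"
  shows "closed (gauge_lumpable \<kappa> E)"
proof -
  have cl: "closed (gauge_lumpable \<kappa> E \<inter> cball 0 r)" for r
    using compact_continuous_image[OF continuous_on_fst[OF continuous_on_id] compact_gauge_pairs[OF E \<kappa>, of r]]
    by (simp add: fst_gauge_pairs compact_imp_closed)
  show ?thesis
    unfolding closed_sequential_limits
  proof (intro allI impI, elim conjE)
    fix x l assume x: "\<forall>n. x n \<in> gauge_lumpable \<kappa> E" "x \<longlonglongrightarrow> l"
    have "bounded (range x)" using x(2) by (rule convergent_imp_bounded)
    then obtain r where "\<And>n. norm (x n) \<le> r" by (auto simp: bounded_iff)
    hence "\<forall>n. x n \<in> gauge_lumpable \<kappa> E \<inter> cball 0 r" using x(1) by simp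
    thus "l \<in> gauge_lumpable \<kappa> E" using cl[of r] x(2) unfolding closed_sequential_limits by blast
  qed
qed

lemma gauge_props:
  fixes \<kappa> :: "'y::finite \<Rightarrow> 'x::finite"
  assumes E: "E \<noteq> {}" "strongly_connected_rel E" and \<kappa>: "surj \<kappa>" and u: "u \<in> gauge_lumpable \<kappa> E"
  shows "section_gauge \<kappa> E u \<in> section_null \<kappa>" "lumpable \<kappa> E (exp_on E (u - grad_on E (section_gauge \<kappa> E u)))"
proof -
  have "\<exists>!f. f \<in> section_null \<kappa> \<and> lumpable \<kappa> E (exp_on E (u - grad_on E f))"
    using u gauge_unique[OF E \<kappa>] by (auto simp: gauge_lumpable_def)
  from theI'[OF this] show "section_gauge \<kappa> E u \<in> section_null \<kappa>" "lumpable \<kappa> E (exp_on E (u - grad_on E (section_gauge \<kappa> E u)))"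
    by (simp_all add: section_gauge_def)
qed

lemma gauge_eqI:
  fixes \<kappa> :: "'y::finite \<Rightarrow> 'x::finite"
  assumes E: "E \<noteq> {}" "strongly_connected_rel E" and \<kappa>: "surj \<kappa>"
    and "f \<in> section_null \<kappa>" "lumpable \<kappa> E (exp_on E (u - grad_on E f))"
  shows "section_gauge \<kappa> E u = f"
  unfolding section_gauge_def using assms gauge_unique[OF E \<kappa>] by (intro the_equality) auto

text \<open>
  The projection from the compact graph to its first component is a continuous injection, so its
  inverse is continuous.
\<close>

lemma continuous_gauge:
  fixes \<kappa> :: "'y::finite \<Rightarrow> 'x::finite"
  assumes E: "E \<noteq> {}" "strongly_connected_rel E" and \<kappa>: "surj \<kappa>"
  shows "continuous_on (gauge_lumpable \<kappa> E \<inter> cball 0 r) (section_gauge \<kappa> E)"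
proof -
  have "continuous_on (fst ` gauge_pairs \<kappa> E r) (\<lambda>u. (u, section_gauge \<kappa> E u))"
    by (rule continuous_on_inv[OF continuous_on_fst[OF continuous_on_id] compact_gauge_pairs[OF E \<kappa>]])
      (auto simp: gauge_pairs_def intro: gauge_eqI[OF E \<kappa>])
  from continuous_on_snd[OF this] show ?thesis by (simp add: fst_gauge_pairs)
qed

section \<open>Dimension of the parameter space\<close>

lemma dim_section_null:
  fixes \<kappa> :: "'y::finite \<Rightarrow> 'x::finite"
  assumes \<kappa>: "surj \<kappa>"
  shows "dim (section_null \<kappa>) + CARD('x) = CARD('y)"
proof -
  define d where "d = (\<lambda>y. axis y (1::real)) ` (- range (inv \<kappa>))"
  have "section_null \<kappa> = {f. \<forall>i\<in>Basis. i \<notin> d \<longrightarrow> f \<bullet> i = 0}"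
    by (auto simp: section_null_def d_def Basis_vec_def inner_axis image_iff axis_eq_axis)
  also have "dim \<dots> = card d" by (rule dim_substandard) (auto simp: d_def Basis_vec_def)
  also have "\<dots> = card (- range (inv \<kappa>))"
    unfolding d_def by (intro card_image inj_onI) (simp add: axis_eq_axis)
  also have "\<dots> + CARD('x) = CARD('y)"
    using card_image[OF surj_imp_inj_inv[OF \<kappa>]] card_mono[of UNIV "range (inv \<kappa>)"]
    by (simp add: Compl_eq_Diff_UNIV card_Diff_subset)
  finally show ?thesis .
qed

lemma dim_edge_funs: "dim (edge_funs E) = card E"
proof -
  define d where "d = (\<lambda>(y, y'). axis y (axis y' (1::real))) ` E"
  have d: "axis y (axis y' 1) \<in> d \<longleftrightarrow> (y, y') \<in> E" for y y'
    by (force simp: d_def axis_eq_axis)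
  have "edge_funs E = {f. \<forall>i\<in>Basis. i \<notin> d \<longrightarrow> f \<bullet> i = 0}"
    by (auto simp: edge_funs_def d Basis_vec_def inner_axis)
  also have "dim \<dots> = card d" by (rule dim_substandard) (auto simp: d_def Basis_vec_def)
  also have "\<dots> = card E"
    unfolding d_def by (intro card_image inj_onI) (auto simp: axis_eq_axis)
  finally show ?thesis .
qed

text \<open>
  A cell is a row \<open>y\<close> together with a fiber that row \<open>y\<close> has to charge in a positive lumpable matrix.
  The lumpability equations prescribe one row mass per cell.
\<close>

definition cells :: "('y::finite \<Rightarrow> 'x::finite) \<Rightarrow> 'y rel \<Rightarrow> ('y \<times> 'x) set" where
  "cells \<kappa> E = {(y, x'). (\<kappa> y, x') \<in> lumped_edges \<kappa> E}"

lemma card_cells: "card (cells \<kappa> E) = (\<Sum>(x, x')\<in>lumped_edges \<kappa> E. card (fiber \<kappa> x))"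
proof -
  have "cells \<kappa> E = (\<Union>(x, x')\<in>lumped_edges \<kappa> E. fiber \<kappa> x \<times> {x'})"
    by (auto simp: cells_def fiber_def)
  also have "card \<dots> = (\<Sum>(x, x')\<in>lumped_edges \<kappa> E. card (fiber \<kappa> x))"
    by (subst card_UN_disjoint) (auto simp: fiber_def card_cartesian_product case_prod_unfold)
  finally show ?thesis .
qed

text \<open>
  Some row in the fiber of \<open>y\<close> has positive mass on the fiber of \<open>x'\<close>, hence by lumpability row \<open>y\<close>
  has it too. Without a positive lumpable matrix a cell could be empty and the dimension count would
  fail.
\<close>

lemma cell_has_edge:
  assumes F: "F \<in> lumpable_pos_edge_funs \<kappa> E" and c: "(y, x') \<in> cells \<kappa> E"
  shows "\<exists>y'. (y, y') \<in> E \<and> \<kappa> y' = x'"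
proof (rule ccontr)
  assume "\<nexists>y'. (y, y') \<in> E \<and> \<kappa> y' = x'"
  hence "row_mass F y (fiber \<kappa> x') = 0"
    using F by (auto simp: row_mass_def fiber_def lumpable_pos_edge_funs_def pos_edge_funs_def edge_funs_def intro!: sum.neutral)
  moreover obtain z z' where z: "(z, z') \<in> E" "\<kappa> z = \<kappa> y" "\<kappa> z' = x'"
    using c by (force simp: cells_def lumped_edges_def)
  have "F \<in> pos_edge_funs E" using F by (simp add: lumpable_pos_edge_funs_def)
  hence "0 < row_mass F z (fiber \<kappa> x')" using z by (intro row_mass_pos) auto
  moreover have "row_mass F z (fiber \<kappa> x') = row_mass F y (fiber \<kappa> x')"
  proof -
    have "lumpable \<kappa> E F" "(\<kappa> z, x') \<in> lumped_edges \<kappa> E"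
      using F z c by (auto simp: lumpable_pos_edge_funs_def cells_def)
    thus ?thesis using z(2) unfolding lumpable_iff by blast
  qed
  ultimately show False by simp
qed

text \<open>
  Fix one edge in each cell. A lumpable matrix is freely determined by its lumped matrix and its
  entries on the other edges, because the entry at the chosen edge is what is missing to the
  prescribed row mass.
\<close>

lemma dim_lumpable_edge_funs:
  fixes \<kappa> :: "'y::finite \<Rightarrow> 'x::finite"
  assumes \<kappa>: "surj \<kappa>" and ne: "lumpable_pos_edge_funs \<kappa> E \<noteq> {}"
  shows "dim (lumpable_edge_funs \<kappa> E) + card (cells \<kappa> E) = card E + card (lumped_edges \<kappa> E)"
proof -
  have "\<forall>c\<in>cells \<kappa> E. \<exists>y'. (fst c, y') \<in> E \<and> \<kappa> y' = snd c"
    using ne cell_has_edge by fastforce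
  then obtain t where t: "\<And>c. c \<in> cells \<kappa> E \<Longrightarrow> (fst c, t c) \<in> E \<and> \<kappa> (t c) = snd c"
    by metis
  define R where "R = (\<lambda>c. (fst c, t c)) ` cells \<kappa> E"
  have RE: "R \<subseteq> E" using t by (auto simp: R_def)
  have cR: "card R = card (cells \<kappa> E)"
    unfolding R_def using t by (intro card_image inj_onI) (metis prod.collapse prod.inject)
  define \<Phi> where "\<Phi> = (\<lambda>F :: 'y rmatrix. (\<chi> y y'. if (y, y') \<in> E - R then F $ y $ y' else 0, lumped \<kappa> E F))"
  have lin: "linear \<Phi>"
    by (rule linearI) (auto simp: \<Phi>_def vec_eq_iff lumped_def row_mass_add row_mass_scale)
  have split: "row_mass F y (fiber \<kappa> x') = F $ y $ t (y, x') + (\<Sum>y'\<in>fiber \<kappa> x' - {t (y, x')}. F $ y $ y')"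
    if "(y, x') \<in> cells \<kappa> E" for F :: "'y rmatrix" and y x'
    unfolding row_mass_def using t[OF that] by (intro sum.remove) (auto simp: fiber_def)
  have notR: "(y, y') \<notin> R" if "y' \<in> fiber \<kappa> x' - {t (y, x')}" for y y' x'
    using that t by (auto simp: R_def fiber_def)
  have inj: "inj_on \<Phi> (span (lumpable_edge_funs \<kappa> E))"
    unfolding span_eq_iff[THEN iffD2, OF subspace_lumpable_edge_funs]
      linear_inj_on_iff_eq_0[OF lin subspace_lumpable_edge_funs]
  proof (intro ballI impI)
    fix F assume F: "F \<in> lumpable_edge_funs \<kappa> E" and 0: "\<Phi> F = 0"
    have off: "F $ y $ y' = 0" if "(y, y') \<notin> R" for y y'
    proof (cases "(y, y') \<in> E")
      case True
      thus ?thesis using 0 that by (auto simp: \<Phi>_def vec_eq_iff zero_prod_def split: if_splits)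
    next
      case False
      thus ?thesis using F by (auto simp: lumpable_edge_funs_def edge_funs_def)
    qed
    have "F $ y $ t (y, x') = 0" if c: "(y, x') \<in> cells \<kappa> E" for y x'
    proof -
      have "row_mass F y (fiber \<kappa> x') = 0"
        using 0 by (simp add: row_mass_lumped[OF F \<kappa>] \<Phi>_def zero_prod_def)
      moreover have "(\<Sum>y'\<in>fiber \<kappa> x' - {t (y, x')}. F $ y $ y') = 0"
        using notR off by (intro sum.neutral) blast
      ultimately show ?thesis using split[OF c, of F] by simp
    qed
    hence "F $ y $ y' = 0" if "(y, y') \<in> R" for y y' using that by (auto simp: R_def)
    thus "F = 0" using off by (auto simp: vec_eq_iff)
  qed
  have surj: "\<Phi> ` lumpable_edge_funs \<kappa> E = edge_funs (E - R) \<times> edge_funs (lumped_edges \<kappa> E)"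
  proof (intro equalityI subsetI)
    fix z assume "z \<in> edge_funs (E - R) \<times> edge_funs (lumped_edges \<kappa> E)"
    then obtain M H where z: "z = (M, H)" and M: "M \<in> edge_funs (E - R)" and H: "H \<in> edge_funs (lumped_edges \<kappa> E)"
      by auto
    define F :: "'y rmatrix" where "F = (\<chi> y y'. if (y, y') \<in> R
        then H $ \<kappa> y $ \<kappa> y' - (\<Sum>y''\<in>fiber \<kappa> (\<kappa> y') - {y'}. M $ y $ y'') else M $ y $ y')"
    have F: "F \<in> edge_funs E" using M RE by (auto simp: F_def edge_funs_def)
    have mass: "row_mass F y (fiber \<kappa> x') = H $ \<kappa> y $ x'" for y x'
    proof (cases "(y, x') \<in> cells \<kappa> E")
      case True
      have "(y, t (y, x')) \<in> R" using True by (force simp: R_def)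
      moreover have "(\<Sum>y'\<in>fiber \<kappa> x' - {t (y, x')}. F $ y $ y') = (\<Sum>y'\<in>fiber \<kappa> x' - {t (y, x')}. M $ y $ y')"
        using notR by (intro sum.cong) (auto simp: F_def)
      ultimately show ?thesis using split[OF True, of F] t[OF True] by (simp add: F_def)
    next
      case False
      hence "F $ y $ y' = 0" if "y' \<in> fiber \<kappa> x'" for y'
        using that F by (auto simp: edge_funs_def cells_def lumped_edges_def fiber_def)
      thus ?thesis using False H by (auto simp: row_mass_def edge_funs_def cells_def)
    qed
    have L: "F \<in> lumpable_edge_funs \<kappa> E"
      using F lumpableI[OF mass] by (simp add: lumpable_edge_funs_def)
    have "lumped \<kappa> E F = H"
      using H by (auto simp: lumped_def vec_eq_iff mass surj_f_inv_f[OF \<kappa>] edge_funs_def)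
    moreover have "(\<chi> y y'. if (y, y') \<in> E - R then F $ y $ y' else 0) = M"
      using M by (auto simp: F_def vec_eq_iff edge_funs_def)
    ultimately have "\<Phi> F = z" by (simp add: \<Phi>_def z)
    thus "z \<in> \<Phi> ` lumpable_edge_funs \<kappa> E" using L by blast
  qed (auto simp: \<Phi>_def edge_funs_def lumped_def)
  have "dim (lumpable_edge_funs \<kappa> E) = dim (\<Phi> ` lumpable_edge_funs \<kappa> E)"
    using dim_image_eq[OF lin inj] by simp
  also have "\<dots> = card (E - R) + card (lumped_edges \<kappa> E)"
    unfolding surj by (simp add: dim_Times subspace_edge_funs dim_edge_funs)
  also have "card (E - R) = card E - card (cells \<kappa> E)"
    using RE by (simp add: card_Diff_subset cR)
  finally show ?thesis using card_mono[OF _ RE] cR by simp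
qed

section \<open>The set of gauge lumpable logarithms as a manifold\<close>

text \<open>
  The parametrization of \<^const>\<open>gauge_lumpable\<close> by positive lumpable matrices and potentials, an
  open part of a linear space whose dimension is the number in the theorem.
\<close>

definition regauge :: "('y::finite) rel \<Rightarrow> 'y rmatrix \<times> (real ^ 'y) \<Rightarrow> 'y rmatrix" where
  "regauge E = (\<lambda>(F, f). log_on E F + grad_on E f)"

lemma regauge_image:
  fixes \<kappa> :: "'y::finite \<Rightarrow> 'x::finite"
  shows "regauge E ` (lumpable_pos_edge_funs \<kappa> E \<times> section_null \<kappa>) = gauge_lumpable \<kappa> E"
proof (intro equalityI subsetI)
  fix u assume "u \<in> regauge E ` (lumpable_pos_edge_funs \<kappa> E \<times> section_null \<kappa>)"
  then obtain F f where F: "F \<in> lumpable_pos_edge_funs \<kappa> E" and f: "f \<in> section_null \<kappa>"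
    and u: "u = log_on E F + grad_on E f"
    by (auto simp: regauge_def)
  have "exp_on E (u - grad_on E f) = F" using F by (simp add: u exp_log_on lumpable_pos_edge_funs_def)
  moreover have "u \<in> edge_funs E"
    unfolding u by (intro subspace_add subspace_edge_funs log_on_edge grad_on_edge)
  ultimately show "u \<in> gauge_lumpable \<kappa> E"
    using f F by (auto simp: gauge_lumpable_def lumpable_pos_edge_funs_def)
next
  fix u assume "u \<in> gauge_lumpable \<kappa> E"
  then obtain f where u: "u \<in> edge_funs E" and f: "f \<in> section_null \<kappa>"
      "lumpable \<kappa> E (exp_on E (u - grad_on E f))"
    by (auto simp: gauge_lumpable_def)
  have "u - grad_on E f \<in> edge_funs E" by (intro subspace_diff subspace_edge_funs u grad_on_edge)
  hence "u = regauge E (exp_on E (u - grad_on E f), f)" by (simp add: regauge_def log_exp_on)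
  thus "u \<in> regauge E ` (lumpable_pos_edge_funs \<kappa> E \<times> section_null \<kappa>)"
    using f exp_on_pos by (auto simp: lumpable_pos_edge_funs_def)
qed

lemma gauge_regauge:
  fixes \<kappa> :: "'y::finite \<Rightarrow> 'x::finite"
  assumes E: "E \<noteq> {}" "strongly_connected_rel E" and \<kappa>: "surj \<kappa>"
    and F: "F \<in> lumpable_pos_edge_funs \<kappa> E" and f: "f \<in> section_null \<kappa>"
  shows "section_gauge \<kappa> E (regauge E (F, f)) = f"
  by (rule gauge_eqI[OF E \<kappa> f]) (use F in \<open>simp add: regauge_def exp_log_on lumpable_pos_edge_funs_def\<close>)

text \<open>
  The potential is recovered from the image by uniqueness of the gauge, and then the matrix by the
  exponential.
\<close>

lemma inj_regauge:
  fixes \<kappa> :: "'y::finite \<Rightarrow> 'x::finite"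
  assumes E: "E \<noteq> {}" "strongly_connected_rel E" and \<kappa>: "surj \<kappa>"
  shows "inj_on (regauge E) (lumpable_pos_edge_funs \<kappa> E \<times> section_null \<kappa>)"
proof (rule inj_onI)
  fix z z' assume z: "z \<in> lumpable_pos_edge_funs \<kappa> E \<times> section_null \<kappa>"
    "z' \<in> lumpable_pos_edge_funs \<kappa> E \<times> section_null \<kappa>" and eq: "regauge E z = regauge E z'"
  have "snd z = snd z'"
    using z eq gauge_regauge[OF E \<kappa>, of "fst z" "snd z"] gauge_regauge[OF E \<kappa>, of "fst z'" "snd z'"]
    by (auto simp: mem_Times_iff)
  moreover from this have "exp_on E (log_on E (fst z)) = exp_on E (log_on E (fst z'))"
    using eq by (simp add: regauge_def case_prod_unfold)
  ultimately show "z = z'"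
    using z by (auto simp: exp_log_on lumpable_pos_edge_funs_def mem_Times_iff prod_eq_iff)
qed

lemma continuous_regauge:
  "continuous_on (lumpable_pos_edge_funs \<kappa> E \<times> A) (regauge E)"
proof -
  have "continuous_on (lumpable_pos_edge_funs \<kappa> E \<times> A) (\<lambda>z. log_on E (fst z) $ y $ y')" for y y'
  proof (cases "(y, y') \<in> E")
    case True
    have "fst z $ y $ y' \<noteq> 0" if "z \<in> lumpable_pos_edge_funs \<kappa> E \<times> A" for z
      using that True by (force simp: lumpable_pos_edge_funs_def pos_edge_funs_def)
    hence "continuous_on (lumpable_pos_edge_funs \<kappa> E \<times> A) (\<lambda>z. ln (fst z $ y $ y'))"
      by (intro continuous_intros) auto
    thus ?thesis using True by (simp add: log_on_def)
  qed (simp add: log_on_def)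
  hence "continuous_on (lumpable_pos_edge_funs \<kappa> E \<times> A) (\<lambda>z. \<chi> y y'. log_on E (fst z) $ y $ y')"
    by (intro continuous_on_vec_lambda)
  hence "continuous_on (lumpable_pos_edge_funs \<kappa> E \<times> A) (\<lambda>z. log_on E (fst z))"
    by (simp add: vec_lambda_eta)
  moreover have "continuous_on (lumpable_pos_edge_funs \<kappa> E \<times> A) (\<lambda>z. grad_on E (snd z))"
    by (intro continuous_on_compose2[OF linear_continuous_on[OF linear_conv_bounded_linear[THEN iffD1, OF grad_on_linear]]]
        continuous_intros) auto
  ultimately show ?thesis unfolding regauge_def case_prod_unfold by (intro continuous_on_add)
qed

lemma openin_lumpable_pos:
  fixes E :: "('y::finite) rel"
  shows
  "openin (top_of_set (lumpable_edge_funs \<kappa> E)) (lumpable_pos_edge_funs \<kappa> E)"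
proof -
  define P where "P = (\<Inter>(y, y')\<in>E. {F :: 'y rmatrix. 0 < F $ y $ y'})"
  have "open P" unfolding P_def case_prod_unfold
    by (intro open_INT) (auto intro!: open_Collect_less continuous_intros)
  moreover have "lumpable_pos_edge_funs \<kappa> E = lumpable_edge_funs \<kappa> E \<inter> P"
    by (auto simp: lumpable_pos_edge_funs_eq lumpable_edge_funs_def pos_edge_funs_def P_def)
  ultimately show ?thesis unfolding openin_open by blast
qed

context
  fixes E :: "('y::finite) rel" and \<kappa> :: "'y \<Rightarrow> 'x::finite"
  assumes E: "E \<noteq> {}" "strongly_connected_rel E" and \<kappa>: "surj \<kappa>"
begin

lemma openin_parameters:
  "openin (top_of_set (lumpable_edge_funs \<kappa> E \<times> section_null \<kappa>)) (lumpable_pos_edge_funs \<kappa> E \<times> section_null \<kappa>)"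
  by (intro openin_Times openin_lumpable_pos openin_subtopology_self)

lemma subspace_parameters: "subspace (lumpable_edge_funs \<kappa> E \<times> section_null \<kappa>)"
  by (intro subspace_Times subspace_lumpable_edge_funs subspace_section_null)

text \<open>
  The parametrization is a continuous injection from an open set of parameters into \<open>U\<close>, and
  continuous injections do not lower the dimension.
\<close>

lemma dim_parameters_le:
  assumes ne: "lumpable_pos_edge_funs \<kappa> E \<noteq> {}" and U: "subspace U" "gauge_lumpable \<kappa> E \<subseteq> U"
  shows "dim (lumpable_edge_funs \<kappa> E \<times> section_null \<kappa>) \<le> dim U"
proof (rule invariance_of_dimension_subspaces[OF openin_parameters subspace_parameters U(1) continuous_regauge _ inj_regauge[OF E \<kappa>]])
  show "regauge E \<in> lumpable_pos_edge_funs \<kappa> E \<times> section_null \<kappa> \<rightarrow> U"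
    using regauge_image[of E \<kappa>] U(2) by blast
  show "lumpable_pos_edge_funs \<kappa> E \<times> section_null \<kappa> \<noteq> {}"
    using ne subspace_0[OF subspace_section_null] by auto
qed

text \<open>
  In equal dimensions the image of the parametrization is open, by invariance of domain. It is also
  closed, and \<open>U\<close> is connected.
\<close>

lemma gauge_lumpable_eq_subspace:
  assumes ne: "lumpable_pos_edge_funs \<kappa> E \<noteq> {}" and U: "subspace U" "gauge_lumpable \<kappa> E \<subseteq> U"
    and dim: "dim U = dim (lumpable_edge_funs \<kappa> E \<times> section_null \<kappa>)"
  shows "gauge_lumpable \<kappa> E = U"
proof -
  have "openin (top_of_set U) (regauge E ` (lumpable_pos_edge_funs \<kappa> E \<times> section_null \<kappa>))"
  proof (rule invariance_of_domain_subspaces[OF openin_parameters subspace_parameters U(1) _ continuous_regauge _ inj_regauge[OF E \<kappa>]])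
    show "regauge E \<in> lumpable_pos_edge_funs \<kappa> E \<times> section_null \<kappa> \<rightarrow> U"
      using regauge_image[of E \<kappa>] U(2) by blast
  qed (simp add: dim)
  hence "openin (top_of_set U) (gauge_lumpable \<kappa> E)" by (simp add: regauge_image)
  moreover have "closedin (top_of_set U) (gauge_lumpable \<kappa> E)"
    by (intro closed_subset U closed_gauge_lumpable[OF E \<kappa>])
  moreover have "gauge_lumpable \<kappa> E \<noteq> {}"
    using ne subspace_0[OF subspace_section_null[of \<kappa>]] unfolding regauge_image[symmetric] by blast
  moreover have "connected U" by (intro convex_connected subspace_imp_convex U)
  ultimately show ?thesis unfolding connected_clopen by blast
qed

text \<open>
  The inverse of the parametrization is continuous on the unit ball of \<open>U\<close>, so invariance of
  dimension applies in the other direction.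
\<close>

lemma dim_gauge_lumpable_le:
  assumes U: "subspace U" "gauge_lumpable \<kappa> E = U"
  shows "dim U \<le> dim (lumpable_edge_funs \<kappa> E \<times> section_null \<kappa>)"
proof (rule invariance_of_dimension_subspaces[OF openin_open_Int[OF open_ball[of 0 1]] U(1) subspace_parameters])
  define h where "h = (\<lambda>u. (exp_on E (u - grad_on E (section_gauge \<kappa> E u)), section_gauge \<kappa> E u))"
  have g: "continuous_on (U \<inter> ball 0 1) (section_gauge \<kappa> E)"
    by (rule continuous_on_subset[OF continuous_gauge[OF E \<kappa>, of 1]]) (auto simp: U(2))
  have "continuous_on (U \<inter> ball 0 1) (\<lambda>u. (\<lambda>(u, f). exp_on E (u - grad_on E f)) (u, section_gauge \<kappa> E u))"
    by (rule continuous_on_compose2[OF continuous_exp_grad[of UNIV]]) (auto intro!: continuous_intros g)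
  thus "continuous_on (U \<inter> ball 0 1) h"
    unfolding h_def by (intro continuous_on_Pair g) simp
  have props: "section_gauge \<kappa> E u \<in> section_null \<kappa>" "lumpable \<kappa> E (exp_on E (u - grad_on E (section_gauge \<kappa> E u)))"
      "u \<in> edge_funs E" if "u \<in> U" for u
    using gauge_props[OF E \<kappa>, of u] that U(2) by (auto simp: gauge_lumpable_def)
  show "h \<in> U \<inter> ball 0 1 \<rightarrow> lumpable_edge_funs \<kappa> E \<times> section_null \<kappa>"
    using props exp_on_edge by (auto simp: h_def lumpable_edge_funs_def)
  have "regauge E (h u) = u" if "u \<in> U" for u
    using log_exp_on[OF subspace_diff[OF subspace_edge_funs props(3)[OF that] grad_on_edge]]
    by (simp add: regauge_def h_def)
  thus "inj_on h (U \<inter> ball 0 1)" by (metis inj_on_inverseI IntD1)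
  show "U \<inter> ball 0 1 \<noteq> {}" using subspace_0[OF U(1)] by auto
qed

section \<open>Linearity of the gauge lumpable set and e-families\<close>

text \<open>
  Take \<open>K = 0\<close> and for \<open>G\<close> a basis of the orthogonal complement of the null space inside the set.
  Normalization does not see the component in the null space, so the family consists of the
  normalizations of all matrices with logarithm in the set.
\<close>

lemma e_family_if_gauge_subspace:
  assumes U: "subspace (gauge_lumpable \<kappa> E)"
  shows "e_family E (lumpable_stochastic_mats \<kappa> E)"
proof -
  define N where "N = null_space E"
  define U where "U = gauge_lumpable \<kappa> E"
  have UG: "U = log_lumpable \<kappa> E + N" by (simp add: U_def N_def gauge_lumpable_eq_sum[OF \<kappa>])
  have sU: "subspace U" using U by (simp add: U_def)
  have sN: "subspace N" by (simp add: N_def subspace_null_space)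
  have UE: "U \<subseteq> edge_funs E" by (auto simp: U_def gauge_lumpable_def)
  have NU: "N \<subseteq> U"
  proof
    fix n assume n: "n \<in> N"
    obtain g m where gm: "g \<in> log_lumpable \<kappa> E" "m \<in> N" "0 = g + m"
      using subspace_0[OF sU] unfolding UG by (rule set_plus_elim)
    hence "n = g + (m + n)" by (simp add: add.assoc[symmetric])
    thus "n \<in> U" unfolding UG using gm n subspace_add[OF sN] by (metis set_plus_intro)
  qed
  define P where "P = {u \<in> U. \<forall>n\<in>N. orthogonal n u}"
  have sP: "subspace P"
    using sU by (auto simp: P_def subspace_def orthogonal_def inner_add_right)
  have PN: "p = 0" if "p \<in> P" "p \<in> N" for p
    using that by (auto simp: P_def orthogonal_def)
  have decomp: "\<exists>n p. n \<in> N \<and> p \<in> P \<and> u = p + n" if "u \<in> U" for u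
  proof -
    obtain n p where np: "n \<in> span N" "\<And>w. w \<in> span N \<Longrightarrow> orthogonal p w" "u = n + p"
      using orthogonal_subspace_decomp_exists[of N u] by metis
    have nN: "n \<in> N" using np(1) by (simp add: span_eq_iff[THEN iffD2, OF sN])
    have "p = u - n" using np(3) by simp
    hence "p \<in> U" using that nN NU by (auto intro: subspace_diff[OF sU])
    hence "p \<in> P" using np(2) span_superset by (auto simp: P_def orthogonal_commute)
    thus ?thesis using nN np(3) by (metis add.commute)
  qed
  obtain B where B: "B \<subseteq> P" "independent B" "P \<subseteq> span B" by (rule basis_exists)
  have finB: "finite B" by (rule independent_imp_finite[OF B(2)])
  obtain G where G: "bij_betw G {1..card B} B" using ex_bij_betw_nat_finite_1[OF finB] by blast
  define d where "d = card B"
  have sumG: "(\<Sum>i=1..d. a (G i) *\<^sub>R G i) = (\<Sum>b\<in>B. a b *\<^sub>R b)" for a :: "'y rmatrix \<Rightarrow> real"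
    unfolding d_def by (rule sum.reindex_bij_betw[OF G])
  have GP: "G i \<in> P" if "i \<in> {1..d}" for i
    using bij_betwE[OF G] B(1) that by (auto simp: d_def)
  have combP: "(\<Sum>i=1..d. \<theta> i *\<^sub>R G i) \<in> P" for \<theta> :: "nat \<Rightarrow> real"
    by (intro subspace_sum[OF sP] subspace_scale[OF sP] GP)
  have "independent_modulo N d G"
    unfolding independent_modulo_def
  proof (intro allI impI)
    fix a :: "nat \<Rightarrow> real" assume aN: "(\<Sum>i=1..d. a i *\<^sub>R G i) \<in> N"
    \<comment> \<open>The coefficients a, indexed by basis vectors instead of numbers.\<close>
    define b where "b = (\<lambda>v. a (inv_into {1..d} G v))"
    have bG: "b (G i) = a i" if "i \<in> {1..d}" for i
      using that G by (simp add: b_def d_def bij_betw_inv_into_left)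
    have "(\<Sum>v\<in>B. b v *\<^sub>R v) = (\<Sum>i=1..d. a i *\<^sub>R G i)"
      unfolding sumG[symmetric] using bG by (intro sum.cong) auto
    also have "\<dots> = 0" by (rule PN[OF combP aN])
    finally have "(\<Sum>v\<in>B. b v *\<^sub>R v) = 0" .
    hence "b v = 0" if "v \<in> B" for v using independentD[OF B(2) finB subset_refl] that by blast
    thus "\<forall>i\<in>{1..d}. a i = 0" using bG bij_betwE[OF G] by (metis d_def)
  qed
  moreover have "lumpable_stochastic_mats \<kappa> E = {stoch_normalize (exp_on E (0 + (\<Sum>i=1..d. \<theta> i *\<^sub>R G i))) | \<theta> :: nat \<Rightarrow> real. True}"
  proof (intro equalityI subsetI)
    fix W assume W: "W \<in> lumpable_stochastic_mats \<kappa> E"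
    hence W': "W \<in> stochastic_mats E" "W \<in> pos_edge_funs E" "W \<in> lumpable_pos_edge_funs \<kappa> E"
      by (auto simp: lumpable_stochastic_mats_def stochastic_mats_def lumpable_pos_edge_funs_def)
    have "log_on E W \<in> log_lumpable \<kappa> E" using W' by (auto simp: log_lumpable_def)
    hence "log_on E W + 0 \<in> U" unfolding UG by (rule set_plus_intro) (rule subspace_0[OF sN])
    then obtain n p where np: "n \<in> N" "p \<in> P" "log_on E W = p + n" using decomp by fastforce
    obtain a where "p = (\<Sum>b\<in>B. a b *\<^sub>R b)" using np(2) B(3) unfolding span_finite[OF finB] by blast
    hence p: "p = (\<Sum>i=1..d. a (G i) *\<^sub>R G i)" by (simp only: sumG)
    have "W = stoch_normalize (exp_on E (log_on E W))"
      using W' by (simp add: exp_log_on stoch_normalize_stochastic_id[OF E])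
    also have "\<dots> = stoch_normalize (exp_on E (0 + p))"
      using stoch_normalize_add_null[OF E] np by (simp add: N_def)
    finally show "W \<in> {stoch_normalize (exp_on E (0 + (\<Sum>i=1..d. \<theta> i *\<^sub>R G i))) | \<theta> :: nat \<Rightarrow> real. True}"
      unfolding p by (intro CollectI exI[of _ "\<lambda>i. a (G i)"]) auto
  next
    fix W assume "W \<in> {stoch_normalize (exp_on E (0 + (\<Sum>i=1..d. \<theta> i *\<^sub>R G i))) | \<theta> :: nat \<Rightarrow> real. True}"
    then obtain \<theta> where W: "W = stoch_normalize (exp_on E (\<Sum>i=1..d. \<theta> i *\<^sub>R G i))" by auto
    have "(\<Sum>i=1..d. \<theta> i *\<^sub>R G i) \<in> U" using combP by (auto simp: P_def)
    then obtain g n where gn: "(\<Sum>i=1..d. \<theta> i *\<^sub>R G i) = g + n" "g \<in> log_lumpable \<kappa> E" "n \<in> N"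
      unfolding UG by (rule set_plus_elim)
    then obtain F where F: "F \<in> lumpable_pos_edge_funs \<kappa> E" "g = log_on E F"
      by (auto simp: log_lumpable_def)
    have "W = stoch_normalize F"
      using F gn stoch_normalize_add_null[OF E]
      by (simp add: W N_def exp_log_on lumpable_pos_edge_funs_def)
    thus "W \<in> lumpable_stochastic_mats \<kappa> E" using stoch_normalize_lumpable[OF E \<kappa> F(1)] by simp
  qed
  moreover have "G i \<in> edge_funs E" if "i \<in> {1..d}" for i
    using GP[OF that] UE by (auto simp: P_def)
  ultimately show ?thesis
    unfolding e_family_def N_def
    using subspace_0[OF subspace_edge_funs[of E]]
    by (intro conjI exI[of _ d] exI[of _ "0 :: 'y rmatrix"] exI[of _ G])
      (auto simp: lumpable_stochastic_mats_def)
qed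

end

definition edge_unit :: "'y::finite \<Rightarrow> 'y \<Rightarrow> 'y rmatrix" where
  "edge_unit y z = axis y (axis z 1)"

lemma edge_unit_nth: "edge_unit y z $ i $ j = (if i = y \<and> j = z then 1 else 0)"
  by (auto simp: edge_unit_def axis_def)

lemma matrix_eq_sum_edge_units: "M = (\<Sum>y\<in>UNIV. \<Sum>z\<in>UNIV. M $ y $ z *\<^sub>R edge_unit y z)"
proof -
  have "(\<Sum>y\<in>UNIV. \<Sum>z\<in>UNIV. M $ y $ z * (if i = y \<and> j = z then 1 else 0)) = M $ i $ j" for i j
  proof -
    have "(\<Sum>z\<in>UNIV. M $ y $ z * (if i = y \<and> j = z then 1 else 0)) = (if i = y then M $ i $ j else 0)" for y
      by (cases "i = y") (simp_all add: sum.delta if_distrib cong: if_cong)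
    thus ?thesis by simp
  qed
  thus ?thesis by (simp add: vec_eq_iff edge_unit_nth)
qed

definition cell_degree :: "('y::finite \<Rightarrow> 'x) \<Rightarrow> 'y rel \<Rightarrow> 'y \<Rightarrow> 'x \<Rightarrow> nat" where
  "cell_degree \<kappa> E y x' = card {y' \<in> fiber \<kappa> x'. (y, y') \<in> E}"

definition uniform_on_cells :: "('y::finite \<Rightarrow> 'x) \<Rightarrow> 'y rel \<Rightarrow> 'y rmatrix" where
  "uniform_on_cells \<kappa> E = (\<chi> y y'. if (y, y') \<in> E then 1 / real (cell_degree \<kappa> E y (\<kappa> y')) else 0)"

lemma cell_degree_pos: "(y, y') \<in> E \<Longrightarrow> \<kappa> y' = x' \<Longrightarrow> 0 < cell_degree \<kappa> E y x'"
  by (auto simp: cell_degree_def card_gt_0_iff fiber_def)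

lemma uniform_on_cells_lumpable:
  fixes \<kappa> :: "'y::finite \<Rightarrow> 'x::finite"
  assumes ne: "lumpable_pos_edge_funs \<kappa> E \<noteq> {}"
  shows "uniform_on_cells \<kappa> E \<in> lumpable_pos_edge_funs \<kappa> E"
proof -
  obtain F where F: "F \<in> lumpable_pos_edge_funs \<kappa> E" using ne by blast
  have mass: "row_mass (uniform_on_cells \<kappa> E) y (fiber \<kappa> x') = 1" if D: "(\<kappa> y, x') \<in> lumped_edges \<kappa> E" for y x'
  proof -
    have "0 < cell_degree \<kappa> E y x'"
      using cell_has_edge[OF F, of y x'] D cell_degree_pos by (fastforce simp: cells_def)
    moreover have "row_mass (uniform_on_cells \<kappa> E) y (fiber \<kappa> x')
        = (\<Sum>y'\<in>fiber \<kappa> x'. if (y, y') \<in> E then 1 / real (cell_degree \<kappa> E y x') else 0)"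
      unfolding row_mass_def by (intro sum.cong) (auto simp: uniform_on_cells_def fiber_def)
    moreover have "\<dots> = real (cell_degree \<kappa> E y x') * (1 / real (cell_degree \<kappa> E y x'))"
      unfolding cell_degree_def by (subst sum.inter_filter[symmetric]) auto
    ultimately show ?thesis by simp
  qed
  have "lumpable \<kappa> E (uniform_on_cells \<kappa> E)"
    unfolding lumpable_iff by (metis mass)
  thus ?thesis using cell_degree_pos[of _ _ E \<kappa>]
    by (auto simp: lumpable_pos_edge_funs_def pos_edge_funs_def edge_funs_def uniform_on_cells_def)
qed

text \<open>
  Mass is shifted between two entries of the same cell, so that row masses on fibers, and with them
  lumpability, are unaffected. On the logarithmic scale only these two entries change.
\<close>

lemma perturb_cell:
  fixes \<kappa> :: "'y::finite \<Rightarrow> 'x::finite"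
  assumes ne: "lumpable_pos_edge_funs \<kappa> E \<noteq> {}"
    and ab: "(y, a) \<in> E" "(y, b) \<in> E" "a \<noteq> b" "\<kappa> a = \<kappa> b" and s: "0 < s" "s < 2"
  shows "log_on E (uniform_on_cells \<kappa> E) + (ln s *\<^sub>R edge_unit y a + ln (2 - s) *\<^sub>R edge_unit y b) \<in> log_lumpable \<kappa> E"
proof -
  define F0 where "F0 = uniform_on_cells \<kappa> E"
  define D where "D = edge_unit y a - edge_unit y b"
  \<comment> \<open>The entries of the uniform matrix in this cell are all equal, so that the same amount c takes
    the factor at a from 1 to s and the factor at b from 1 to 2 - s.\<close>
  define c where "c = (s - 1) / real (cell_degree \<kappa> E y (\<kappa> b))"
  define F where "F = F0 + c *\<^sub>R D"
  have F0: "F0 \<in> lumpable_pos_edge_funs \<kappa> E" unfolding F0_def by (rule uniform_on_cells_lumpable[OF ne])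
  have deg: "0 < cell_degree \<kappa> E y (\<kappa> b)" using cell_degree_pos ab by metis
  have Fa: "F $ y $ a = F0 $ y $ a * s" and Fb: "F $ y $ b = F0 $ y $ b * (2 - s)"
    and Fo: "\<And>i j. i \<noteq> y \<or> j \<noteq> a \<and> j \<noteq> b \<Longrightarrow> F $ i $ j = F0 $ i $ j"
    using ab deg by (auto simp: F_def D_def c_def F0_def uniform_on_cells_def edge_unit_nth field_simps)
  have "row_mass D i (fiber \<kappa> x') = 0" for i x'
  proof -
    have "row_mass D i (fiber \<kappa> x') = (\<Sum>j\<in>fiber \<kappa> x'. if j = a then (if i = y then 1 else 0) else 0)
        - (\<Sum>j\<in>fiber \<kappa> x'. if j = b then (if i = y then 1 else 0) else 0)"
      unfolding row_mass_def sum_subtractf[symmetric]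
      by (intro sum.cong) (auto simp: D_def edge_unit_nth)
    thus ?thesis using ab(4) by (simp add: sum.delta' sum.delta fiber_def)
  qed
  hence "lumpable \<kappa> E D" by (intro lumpableI[where H = "\<lambda>_ _. 0"]) auto
  moreover have "D \<in> edge_funs E" using ab by (auto simp: edge_funs_def D_def edge_unit_nth)
  ultimately have "F \<in> lumpable_edge_funs \<kappa> E"
    unfolding F_def using F0
    by (intro subspace_add subspace_scale subspace_lumpable_edge_funs)
      (auto simp: lumpable_pos_edge_funs_eq lumpable_edge_funs_def)
  moreover have pos: "0 < F $ i $ j" if "(i, j) \<in> E" for i j
    using F0 that s Fa Fb Fo by (cases "i = y \<and> j = a"; cases "i = y \<and> j = b")
      (auto simp: lumpable_pos_edge_funs_def pos_edge_funs_def)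
  ultimately have F: "F \<in> lumpable_pos_edge_funs \<kappa> E"
    by (auto simp: lumpable_pos_edge_funs_eq pos_edge_funs_def lumpable_edge_funs_def)
  have F0p: "0 < F0 $ i $ j" if "(i, j) \<in> E" for i j
    using F0 that by (auto simp: lumpable_pos_edge_funs_def pos_edge_funs_def)
  have "log_on E F $ i $ j = (log_on E F0 + (ln s *\<^sub>R edge_unit y a + ln (2 - s) *\<^sub>R edge_unit y b)) $ i $ j" for i j
  proof (cases "i = y \<and> (j = a \<or> j = b)")
    case True
    thus ?thesis using ab s Fa Fb F0p[OF ab(1)] F0p[OF ab(2)]
      by (auto simp: log_on_def edge_unit_nth ln_mult_pos)
  next
    case False
    thus ?thesis using Fo[of i j] by (auto simp: log_on_def edge_unit_nth)
  qed
  hence "log_on E F = log_on E F0 + (ln s *\<^sub>R edge_unit y a + ln (2 - s) *\<^sub>R edge_unit y b)"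
    by (simp add: vec_eq_iff)
  thus ?thesis using F by (metis F0_def imageI log_lumpable_def)
qed

text \<open>
  The logarithms of the positive lumpable matrices have an affine hull that passes through \<open>0\<close>:
  already the span of their differences contains all of them. Indeed the logarithm is so far from
  affine that shifting mass within a cell with at least two edges yields, from the differences, the
  unit matrices of all edges of such cells; and the logarithm of the matrix that is uniform on
  cells vanishes at all other edges, so it is a combination of these unit matrices.
\<close>

lemma log_lumpable_subset:
  fixes \<kappa> :: "'y::finite \<Rightarrow> 'x::finite"
  assumes ne: "lumpable_pos_edge_funs \<kappa> E \<noteq> {}" and W: "subspace W"
    and diff: "\<And>g h. g \<in> log_lumpable \<kappa> E \<Longrightarrow> h \<in> log_lumpable \<kappa> E \<Longrightarrow> g - h \<in> W"
  shows "log_lumpable \<kappa> E \<subseteq> W"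
proof -
  define g0 where "g0 = log_on E (uniform_on_cells \<kappa> E)"
  have g0: "g0 \<in> log_lumpable \<kappa> E"
    using uniform_on_cells_lumpable[OF ne] by (simp add: g0_def log_lumpable_def)
  have unit: "edge_unit y a \<in> W" if ab: "(y, a) \<in> E" "(y, b) \<in> E" "a \<noteq> b" "\<kappa> a = \<kappa> b" for y a b
  proof -
    define p q :: real where "p = ln 2" and "q = ln (3/2)"
    have pq: "0 < q" "q < p" by (simp_all add: p_def q_def)
    have half: "ln (1/2 :: real) = - p" by (simp add: p_def ln_div)
    have "ln s *\<^sub>R edge_unit y a + ln (2 - s) *\<^sub>R edge_unit y b \<in> W" if "0 < s" "s < 2" for s
      using diff[OF perturb_cell[OF ne ab that] g0] by (simp add: g0_def)
    \<comment> \<open>The two shifts by the same amount in opposite directions: the logarithmic increments have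
      sizes ln 2 and ln (3/2), so the two vectors are linearly independent.\<close>
    from this[of "1/2"] this[of "3/2"]
    have 1: "- p *\<^sub>R edge_unit y a + q *\<^sub>R edge_unit y b \<in> W"
      and 2: "q *\<^sub>R edge_unit y a + - p *\<^sub>R edge_unit y b \<in> W"
      using half by (simp_all add: q_def)
    have "p *\<^sub>R (- p *\<^sub>R edge_unit y a + q *\<^sub>R edge_unit y b) + q *\<^sub>R (q *\<^sub>R edge_unit y a + - p *\<^sub>R edge_unit y b) \<in> W"
      by (intro subspace_add[OF W] subspace_scale[OF W] 1 2)
    also have "p *\<^sub>R (- p *\<^sub>R edge_unit y a + q *\<^sub>R edge_unit y b) + q *\<^sub>R (q *\<^sub>R edge_unit y a + - p *\<^sub>R edge_unit y b)
        = (q * q - p * p) *\<^sub>R edge_unit y a"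
      by (simp add: algebra_simps)
    finally have "inverse (q * q - p * p) *\<^sub>R ((q * q - p * p) *\<^sub>R edge_unit y a) \<in> W"
      by (rule subspace_scale[OF W])
    moreover have "q * q < p * p" using pq by (intro mult_strict_mono) auto
    ultimately show ?thesis by simp
  qed
  have "g0 $ y $ a *\<^sub>R edge_unit y a \<in> W" for y a
  proof (cases "(y, a) \<in> E \<and> cell_degree \<kappa> E y (\<kappa> a) \<noteq> 1")
    case True
    define S where "S = {y' \<in> fiber \<kappa> (\<kappa> a). (y, y') \<in> E}"
    have "a \<in> S" "card S \<noteq> 1" using True by (auto simp: S_def fiber_def cell_degree_def)
    then obtain b where "b \<in> S" "a \<noteq> b" by (metis is_singletonI' is_singleton_altdef empty_iff)
    hence "edge_unit y a \<in> W" using True by (intro unit[of y a b]) (auto simp: S_def fiber_def)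
    thus ?thesis by (rule subspace_scale[OF W])
  next
    case False
    hence "g0 $ y $ a = 0" by (auto simp: g0_def log_on_def uniform_on_cells_def)
    thus ?thesis using subspace_0[OF W] by simp
  qed
  hence "g0 \<in> W" by (subst matrix_eq_sum_edge_units) (intro subspace_sum[OF W])
  hence "g \<in> W" if "g \<in> log_lumpable \<kappa> E" for g
    using subspace_add[OF W diff[OF that g0]] by fastforce
  thus ?thesis by blast
qed

text \<open>
  Normalization being a translation by the null space, an e-family makes the gauge lumpable set an
  affine space \<open>K + W\<close>, where \<open>W\<close> is spanned by the directions of the family and the null space. The
  differences of elements of \<^const>\<open>log_lumpable\<close> thus lie in \<open>W\<close>, so these elements themselves do,
  which forces \<open>K \<in> W\<close>.
\<close>

lemma gauge_subspace_if_e_family: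
  fixes \<kappa> :: "'y::finite \<Rightarrow> 'x::finite"
  assumes E: "E \<noteq> {}" "strongly_connected_rel E" and \<kappa>: "surj \<kappa>"
    and ne: "lumpable_pos_edge_funs \<kappa> E \<noteq> {}"
    and fam: "e_family E (lumpable_stochastic_mats \<kappa> E)"
  shows "subspace (gauge_lumpable \<kappa> E)"
proof -
  obtain d K G where K: "K \<in> edge_funs E" and G: "\<And>i. i \<in> {1..d} \<Longrightarrow> G i \<in> edge_funs E"
    and V: "lumpable_stochastic_mats \<kappa> E = {stoch_normalize (exp_on E (K + (\<Sum>i=1..d. \<theta> i *\<^sub>R G i))) | \<theta> :: nat \<Rightarrow> real. True}"
    using fam unfolding e_family_def by blast
  define N where "N = null_space E"
  have sN: "subspace N" by (simp add: N_def subspace_null_space)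
  define C where "C = {\<Sum>i=1..d. \<theta> i *\<^sub>R G i | \<theta> :: nat \<Rightarrow> real. True}"
  have sC: "subspace C"
    unfolding subspace_def
  proof (intro conjI ballI allI)
    show "0 \<in> C" unfolding C_def by (intro CollectI exI[of _ "\<lambda>_. 0"]) simp
    fix x assume "x \<in> C"
    then obtain \<theta> where x: "x = (\<Sum>i=1..d. \<theta> i *\<^sub>R G i)" by (auto simp: C_def)
    show "c *\<^sub>R x \<in> C" for c
      unfolding C_def x by (intro CollectI exI[of _ "\<lambda>i. c * \<theta> i"]) (simp add: scaleR_sum_right)
    fix z assume "z \<in> C"
    then obtain \<eta> where z: "z = (\<Sum>i=1..d. \<eta> i *\<^sub>R G i)" by (auto simp: C_def)
    show "x + z \<in> C"
      unfolding C_def x z by (intro CollectI exI[of _ "\<lambda>i. \<theta> i + \<eta> i"]) (simp add: scaleR_left_distrib sum.distrib)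
  qed
  define W where "W = {x + y |x y. x \<in> C \<and> y \<in> N}"
  have sW: "subspace W" unfolding W_def by (rule subspace_sums[OF sC sN])
  have CE: "C \<subseteq> edge_funs E"
    unfolding C_def using G by (auto intro!: subspace_sum subspace_scale subspace_edge_funs)
  have NW: "N \<subseteq> W"
  proof
    fix n assume "n \<in> N"
    moreover have "n = 0 + n" by simp
    ultimately show "n \<in> W" unfolding W_def using subspace_0[OF sC] by blast
  qed
  have gW: "g - K \<in> W" if g: "g \<in> log_lumpable \<kappa> E" for g
  proof -
    obtain F where F: "F \<in> lumpable_pos_edge_funs \<kappa> E" "g = log_on E F"
      using g by (auto simp: log_lumpable_def)
    have F': "F \<in> pos_edge_funs E" using F by (simp add: lumpable_pos_edge_funs_def)
    obtain c where c: "c \<in> C" "stoch_normalize F = stoch_normalize (exp_on E (K + c))"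
      using stoch_normalize_lumpable[OF E \<kappa> F(1)] unfolding V C_def by blast
    obtain n where n: "n \<in> N" "log_on E (stoch_normalize F) = g + n"
      using log_stoch_normalize[OF E F'] F(2) by (metis N_def)
    have "K + c \<in> edge_funs E" using c(1) CE by (intro subspace_add subspace_edge_funs K) auto
    then obtain m where m: "m \<in> N" "log_on E (stoch_normalize (exp_on E (K + c))) = K + c + m"
      using log_stoch_normalize[OF E exp_on_pos] by (metis N_def log_exp_on)
    have "g - K = c + (m - n)" using n(2) m(2) c(2) by (simp add: algebra_simps)
    thus ?thesis using c(1) subspace_diff[OF sN m(1) n(1)] by (auto simp: W_def)
  qed
  have "g - h \<in> W" if "g \<in> log_lumpable \<kappa> E" "h \<in> log_lumpable \<kappa> E" for g h
    using subspace_diff[OF sW gW[OF that(1)] gW[OF that(2)]] by simp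
  hence LW: "log_lumpable \<kappa> E \<subseteq> W" by (rule log_lumpable_subset[OF ne sW])
  obtain g where g: "g \<in> log_lumpable \<kappa> E" using ne by (auto simp: log_lumpable_def)
  have KW: "K \<in> W" using subspace_diff[OF sW subsetD[OF LW g] gW[OF g]] by simp
  have "W = gauge_lumpable \<kappa> E"
  proof (intro equalityI subsetI)
    fix w assume "w \<in> W"
    hence "w - K \<in> W" using KW by (intro subspace_diff[OF sW])
    then obtain c n where cn: "c \<in> C" "n \<in> N" "w - K = c + n" by (auto simp: W_def)
    define A where "A = stoch_normalize (exp_on E (K + c))"
    have "A \<in> lumpable_stochastic_mats \<kappa> E" using cn(1) unfolding V A_def C_def by blast
    hence "log_on E A \<in> log_lumpable \<kappa> E"
      by (auto simp: log_lumpable_def lumpable_stochastic_mats_def lumpable_pos_edge_funs_def stochastic_mats_def)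
    moreover have "K + c \<in> edge_funs E" using cn(1) CE by (intro subspace_add subspace_edge_funs K) auto
    then obtain m where m: "m \<in> N" "log_on E A = K + c + m"
      using log_stoch_normalize[OF E exp_on_pos] by (metis A_def N_def log_exp_on)
    moreover have "w = log_on E A + (n - m)" using m(2) cn(3) by (simp add: algebra_simps)
    ultimately show "w \<in> gauge_lumpable \<kappa> E"
      unfolding gauge_lumpable_eq_sum[OF \<kappa>] using subspace_diff[OF sN cn(2) m(1)]
      by (metis N_def set_plus_intro)
  next
    fix w assume "w \<in> gauge_lumpable \<kappa> E"
    then obtain g n where "w = g + n" "g \<in> log_lumpable \<kappa> E" "n \<in> N"
      unfolding gauge_lumpable_eq_sum[OF \<kappa>] N_def by (rule set_plus_elim)
    thus "w \<in> W" using LW NW subspace_add[OF sW] by blast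
  qed
  thus ?thesis using sW by simp
qed

theorem theorem4p3:
  fixes E :: "('y::finite) rel" and \<kappa> :: "'y \<Rightarrow> 'x::finite"
  assumes "E \<noteq> {}"
    and "strongly_connected_rel E"
    and "surj \<kappa>"
    and "1 < CARD('x)" and "CARD('x) < CARD('y)"
    and "lumpable_stochastic_mats \<kappa> E \<noteq> {}"
  shows "e_family E (lumpable_stochastic_mats \<kappa> E) \<longleftrightarrow>
    int (dim (span (log_lumpable \<kappa> E) + null_space E)) =
      int (card E) + int CARD('y) + int (card (lumped_edges \<kappa> E)) - int CARD('x)
        - (\<Sum>(x, x')\<in>lumped_edges \<kappa> E. int (card (fiber \<kappa> x)))"
proof -
  define U where "U = span (log_lumpable \<kappa> E) + null_space E"
  define k where "k = dim (lumpable_edge_funs \<kappa> E \<times> section_null \<kappa>)"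
  have ne: "lumpable_pos_edge_funs \<kappa> E \<noteq> {}"
    using assms(6) by (auto simp: lumpable_stochastic_mats_def lumpable_pos_edge_funs_def stochastic_mats_def)
  have U: "U = {x + y |x y. x \<in> span (log_lumpable \<kappa> E) \<and> y \<in> null_space E}"
    unfolding U_def set_plus_def by blast
  have sU: "subspace U" unfolding U by (rule subspace_sums[OF subspace_span subspace_null_space])
  have GU: "gauge_lumpable \<kappa> E \<subseteq> U"
    unfolding gauge_lumpable_eq_sum[OF assms(3)] U_def by (rule set_plus_mono2[OF span_superset subset_refl])
  have UG: "U = gauge_lumpable \<kappa> E" if s: "subspace (gauge_lumpable \<kappa> E)"
  proof
    have L: "log_lumpable \<kappa> E \<subseteq> gauge_lumpable \<kappa> E"
      unfolding gauge_lumpable_eq_sum[OF assms(3)]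
      using set_zero_plus2[OF subspace_0[OF subspace_null_space[of E]], of "log_lumpable \<kappa> E"]
      by (simp only: add.commute)
    obtain g where g: "g \<in> log_lumpable \<kappa> E" using ne by (auto simp: log_lumpable_def)
    have "null_space E \<subseteq> gauge_lumpable \<kappa> E"
    proof
      fix n assume "n \<in> null_space E"
      hence "(g + n) - g \<in> gauge_lumpable \<kappa> E"
        using g L gauge_lumpable_eq_sum[OF assms(3)] by (intro subspace_diff[OF s]) auto
      thus "n \<in> gauge_lumpable \<kappa> E" by simp
    qed
    thus "U \<subseteq> gauge_lumpable \<kappa> E"
      using span_minimal[OF L s] subspace_add[OF s] unfolding U by blast
  qed (rule GU)
  have "e_family E (lumpable_stochastic_mats \<kappa> E) \<longleftrightarrow> dim U = k"
  proof
    assume "e_family E (lumpable_stochastic_mats \<kappa> E)"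
    hence "U = gauge_lumpable \<kappa> E" by (intro UG gauge_subspace_if_e_family assms ne)
    thus "dim U = k"
      unfolding k_def using dim_gauge_lumpable_le[OF assms(1-3) sU] dim_parameters_le[OF assms(1-3) ne sU GU]
      by (intro antisym) auto
  next
    assume "dim U = k"
    hence "gauge_lumpable \<kappa> E = U"
      unfolding k_def by (rule gauge_lumpable_eq_subspace[OF assms(1-3) ne sU GU])
    thus "e_family E (lumpable_stochastic_mats \<kappa> E)"
      using sU by (intro e_family_if_gauge_subspace assms) simp
  qed
  moreover have "int k = int (card E) + int CARD('y) + int (card (lumped_edges \<kappa> E)) - int CARD('x)
        - (\<Sum>(x, x')\<in>lumped_edges \<kappa> E. int (card (fiber \<kappa> x)))"
  proof -
    have "(\<Sum>(x, x')\<in>lumped_edges \<kappa> E. int (card (fiber \<kappa> x))) = int (card (cells \<kappa> E))"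
      by (simp add: card_cells case_prod_unfold)
    moreover have "k = dim (lumpable_edge_funs \<kappa> E) + dim (section_null \<kappa>)"
      unfolding k_def by (rule dim_Times[OF subspace_lumpable_edge_funs subspace_section_null])
    ultimately show ?thesis
      using dim_lumpable_edge_funs[OF assms(3) ne] dim_section_null[OF assms(3)] by linarith
  qed
  ultimately show ?thesis unfolding U_def by linarith
qed

end
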